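(* Let $\mathbb{T}=\mathbb{S}^1(\tfrac12)\times\mathbb{S}^1(\tfrac12)$, let $\varphi:\mathbb{T}\to\mathbb{S}^3(\tfrac1{\sqrt2})\subset\mathbb{R}^4$, $\varphi(\gamma,\vartheta)=\big(\tfrac12\cos\gamma,\tfrac12\sin\gamma,\tfrac12\cos\vartheta,\tfrac12\sin\vartheta\big)$, be the minimal Clifford torus, let $i:\mathbb{S}^3(\tfrac1{\sqrt2})\to\mathbb{S}^4$, $i(x)=(x,\tfrac1{\sqrt2})$, be the biharmonic small hypersphere, and let $\Phi=i\circ\varphi$. Let $H(E_2)_\Phi(V,W)=(I_2^{\Phi,\pi}(V),W)$, $V,W\in\mathcal{W}^\varphi$, be the associated quadratic form. Then $$(I_2^{\Phi,\pi}(V),V)\ge0\qquad\forall\,V\in\mathcal{W}^{\varphi}.$$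
   Context: $\mathbb{S}^n(R)$ is the Euclidean $n$-sphere of radius $R$, $\mathbb{S}^n=\mathbb{S}^n(1)$; $\mathbb{T}$ carries the product metric $\frac14(d\gamma^2+d\vartheta^2)$ in the angular coordinates $\gamma,\vartheta\in[0,2\pi]$. $\mathcal{C}(\cdot)$ denotes smooth sections and $(V,W)$ is the $L^2$ inner product of sections. For a smooth map $\phi:M\to N$ with $M$ compact, $\tau(\phi)=\mathrm{trace}\,\nabla d\phi$ and $E_2(\phi)=\frac12\int_M|\tau(\phi)|^2\,dv_M$; $\phi$ is biharmonic if it is a critical point of $E_2$. For a biharmonic map $\phi$, the generalised Jacobi operator $I_2^\phi$ on $\mathcal{C}(\phi^{-1}TN)$ is the fourth-order elliptic self-adjoint operator determined by $\frac{\partial^2}{\partial t\,\partial s}\big|_{(0,0)}E_2(\phi_{t,s})=(I_2^\phi(V),W)$ for every smooth two-parameter variation $\phi_{t,s}$ of $\phi$ with $V=\partial_t\phi_{t,0}|_{t=0}$, $W=\partial_s\phi_{0,s}|_{s=0}$. The map $\Phi$ is (proper) biharmonic. $\mathcal{W}^\varphi\subset\mathcal{C}(\Phi^{-1}T\mathbb{S}^4)$ is the subspace of the variation fields of variations of $\Phi$ of the form $i\circ\varphi_t$ with $\varphi_t:\mathbb{T}\to\mathbb{S}^3(\frac1{\sqrt2})$ a variation of $\varphi$; it is naturally identified with $\mathcal{C}(\varphi^{-1}T\mathbb{S}^3(\frac1{\sqrt2}))$. Let $\pi:\mathcal{C}(\Phi^{-1}T\mathbb{S}^4)\to\mathcal{W}^\varphi$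 be the orthogonal projection and set $I_2^{\Phi,\pi}(V)=\pi(I_2^\Phi(V))$ for $V\in\mathcal{W}^\varphi$. *)

theory Defs
  imports "HOL-Analysis.Analysis"
begin

section \<open>Smooth maps\<close>

primrec Ck_on :: "nat \<Rightarrow> ('a::euclidean_space \<Rightarrow> 'b::euclidean_space) \<Rightarrow> 'a set \<Rightarrow> bool" where
  "Ck_on 0 f S \<longleftrightarrow> continuous_on S f"
| "Ck_on (Suc k) f S \<longleftrightarrow>
     f differentiable_on S \<and> (\<forall>v. Ck_on k (\<lambda>x. frechet_derivative f (at x) v) S)"

text \<open>Only used for open \<open>S\<close>, where the derivative at a point of \<open>S\<close> is unique.\<close>

definition smooth_map_on :: "('a::euclidean_space \<Rightarrow> 'b::euclidean_space) \<Rightarrow> 'a set \<Rightarrow> bool" where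
  "smooth_map_on f S \<longleftrightarrow> (\<forall>k. Ck_on k f S)"


section \<open>The torus in angular coordinates\<close>

text \<open>
  A map on the torus (the product of two circles of radius \<open>1/2\<close>) is represented by its
  expression in the angular coordinates \<open>(\<gamma>, \<theta>)\<close>, i.e. by a map on the plane that is
  \<open>2\<pi>\<close>-periodic in each variable. The metric is \<open>(1/4) (d\<gamma>\<^sup>2 + d\<theta>\<^sup>2)\<close>, so its volume element is
  \<open>(1/4) d\<gamma> d\<theta>\<close> and \<open>2 \<partial>\<^sub>\<gamma>\<close>, \<open>2 \<partial>\<^sub>\<theta>\<close> is a global orthonormal frame.
\<close>

definition torus_periodic :: "(real \<times> real \<Rightarrow> 'b) \<Rightarrow> bool" where
  "torus_periodic f \<longleftrightarrow>
     (\<forall>\<gamma> \<theta>. f (\<gamma> + 2 * pi, \<theta>) = f (\<gamma>, \<theta>) \<and> f (\<gamma>, \<theta> + 2 * pi) = f (\<gamma>, \<theta>))"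

definition torus_frame :: "(real \<times> real) set" where
  "torus_frame = {(2, 0), (0, 2)}"

definition torus_integral :: "(real \<times> real \<Rightarrow> real) \<Rightarrow> real" where
  "torus_integral f = integral (cbox (0, 0) (2 * pi, 2 * pi)) (\<lambda>p. f p / 4)"

definition L2_inner ::
  "(real \<times> real \<Rightarrow> 'b::euclidean_space) \<Rightarrow> (real \<times> real \<Rightarrow> 'b) \<Rightarrow> real" where
  "L2_inner V W = torus_integral (\<lambda>p. V p \<bullet> W p)"


section \<open>Maps from the torus to a round sphere centred at the origin\<close>

definition torus_map :: "'b::euclidean_space set \<Rightarrow> (real \<times> real \<Rightarrow> 'b) \<Rightarrow> bool" where
  "torus_map N \<phi> \<longleftrightarrow> smooth_map_on \<phi> UNIV \<and> torus_periodic \<phi> \<and> range \<phi> \<subseteq> N"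

text \<open>
  The tangent space at \<open>y\<close> of the sphere \<open>sphere 0 (norm y)\<close> is the orthogonal complement of \<open>y\<close>.
\<close>

definition sphere_sections ::
  "(real \<times> real \<Rightarrow> 'b::euclidean_space) \<Rightarrow> (real \<times> real \<Rightarrow> 'b) set" where
  "sphere_sections \<phi> =
     {V. smooth_map_on V UNIV \<and> torus_periodic V \<and> (\<forall>p. V p \<bullet> \<phi> p = 0)}"

definition sphere_tangent_proj :: "'b::euclidean_space \<Rightarrow> 'b \<Rightarrow> 'b" where
  "sphere_tangent_proj y v = v - ((v \<bullet> y) / (y \<bullet> y)) *\<^sub>R y"

text \<open>
  The Levi-Civita connection of the sphere is the tangential part of the flat connection of the
  ambient space; this is the connection it induces on the pull-back bundle, in the direction of a
  tangent vector \<open>X\<close> of the torus.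
\<close>

definition pullback_nabla ::
  "(real \<times> real \<Rightarrow> 'b::euclidean_space) \<Rightarrow> real \<times> real \<Rightarrow>
   (real \<times> real \<Rightarrow> 'b) \<Rightarrow> real \<times> real \<Rightarrow> 'b" where
  "pullback_nabla \<phi> X V p = sphere_tangent_proj (\<phi> p) (frechet_derivative V (at p) X)"

text \<open>
  \<open>(\<nabla>d\<phi>)(X, Y) = \<nabla>\<^sub>X (d\<phi>(Y)) - d\<phi>(\<nabla>\<^sub>X Y)\<close> for vector fields \<open>X\<close>, \<open>Y\<close> with constant coefficients in
  the angular coordinates; the last term vanishes because the metric coefficients are constant.
\<close>

definition second_fundamental_form ::
  "(real \<times> real \<Rightarrow> 'b::euclidean_space) \<Rightarrow> real \<times> real \<Rightarrow> real \<times> real \<Rightarrow> real \<times> real \<Rightarrow> 'b" where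
  "second_fundamental_form \<phi> X Y = pullback_nabla \<phi> X (\<lambda>q. frechet_derivative \<phi> (at q) Y)"

definition tension :: "(real \<times> real \<Rightarrow> 'b::euclidean_space) \<Rightarrow> real \<times> real \<Rightarrow> 'b" where
  "tension \<phi> p = (\<Sum>e\<in>torus_frame. second_fundamental_form \<phi> e e p)"

definition bienergy :: "(real \<times> real \<Rightarrow> 'b::euclidean_space) \<Rightarrow> real" where
  "bienergy \<phi> = 1 / 2 * torus_integral (\<lambda>p. (norm (tension \<phi> p))\<^sup>2)"


section \<open>Variations and the generalised Jacobi operator\<close>

definition variation ::
  "'b::euclidean_space set \<Rightarrow> (real \<times> real \<Rightarrow> 'b) \<Rightarrow> (real \<Rightarrow> real \<times> real \<Rightarrow> 'b) \<Rightarrow> bool" where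
  "variation N \<phi> F \<longleftrightarrow>
     F 0 = \<phi> \<and>
     (\<exists>\<epsilon>>0. smooth_map_on (\<lambda>(t, p). F t p) ({-\<epsilon><..<\<epsilon>} \<times> UNIV) \<and>
            (\<forall>t\<in>{-\<epsilon><..<\<epsilon>}. torus_map N (F t)))"

definition variation2 ::
  "'b::euclidean_space set \<Rightarrow> (real \<times> real \<Rightarrow> 'b) \<Rightarrow>
   (real \<Rightarrow> real \<Rightarrow> real \<times> real \<Rightarrow> 'b) \<Rightarrow> bool" where
  "variation2 N \<phi> F \<longleftrightarrow>
     F 0 0 = \<phi> \<and>
     (\<exists>\<epsilon>>0. smooth_map_on (\<lambda>((t, s), p). F t s p)
              (({-\<epsilon><..<\<epsilon>} \<times> {-\<epsilon><..<\<epsilon>}) \<times> UNIV) \<and>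
            (\<forall>t\<in>{-\<epsilon><..<\<epsilon>}. \<forall>s\<in>{-\<epsilon><..<\<epsilon>}. torus_map N (F t s)))"

definition variation_field ::
  "(real \<Rightarrow> real \<times> real \<Rightarrow> 'b::euclidean_space) \<Rightarrow> real \<times> real \<Rightarrow> 'b" where
  "variation_field F p = vector_derivative (\<lambda>t. F t p) (at 0)"

text \<open>
  For a biharmonic map \<open>\<phi>\<close> to the sphere of radius \<open>r\<close> and a section \<open>V\<close> along it,
  \<open>generalised_jacobi r \<phi> V\<close> is the section \<open>I\<^sub>2(V)\<close> determined by
  \<open>\<partial>\<^sup>2/\<partial>t\<partial>s E\<^sub>2(\<phi>\<^sub>t\<^sub>,\<^sub>s) = (I\<^sub>2(V), W)\<close> at \<open>(0, 0)\<close>, for all two-parameter variations with first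
  variation field \<open>V\<close>, where \<open>W\<close> is the second variation field.
\<close>

definition generalised_jacobi ::
  "real \<Rightarrow> (real \<times> real \<Rightarrow> 'b::euclidean_space) \<Rightarrow> (real \<times> real \<Rightarrow> 'b) \<Rightarrow> (real \<times> real \<Rightarrow> 'b)" where
  "generalised_jacobi r \<phi> V =
     (THE Z. Z \<in> sphere_sections \<phi> \<and>
        (\<forall>F. variation2 (sphere 0 r) \<phi> F \<and> variation_field (\<lambda>t. F t 0) = V \<longrightarrow>
             deriv (\<lambda>t. deriv (\<lambda>s. bienergy (F t s)) 0) 0
               = L2_inner Z (variation_field (\<lambda>s. F 0 s))))"


section \<open>The Clifford torus in the small hypersphere\<close>

text \<open>The ambient space of the unit 4-sphere is \<open>(real^4) \<times> real\<close>.\<close>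

definition clifford_torus :: "real \<times> real \<Rightarrow> real^4" where
  "clifford_torus = (\<lambda>(\<gamma>, \<theta>). vector [cos \<gamma> / 2, sin \<gamma> / 2, cos \<theta> / 2, sin \<theta> / 2])"

definition small_hypersphere_incl :: "real^4 \<Rightarrow> (real^4) \<times> real" where
  "small_hypersphere_incl x = (x, 1 / sqrt 2)"

definition Phi :: "real \<times> real \<Rightarrow> (real^4) \<times> real" where
  "Phi = small_hypersphere_incl \<circ> clifford_torus"

definition W_phi :: "(real \<times> real \<Rightarrow> (real^4) \<times> real) set" where
  "W_phi = {V. \<exists>F. variation (sphere 0 (1 / sqrt 2)) clifford_torus F \<and>
                   V = variation_field (\<lambda>t. small_hypersphere_incl \<circ> F t)}"

definition W_phi_proj ::
  "(real \<times> real \<Rightarrow> (real^4) \<times> real) \<Rightarrow> (real \<times> real \<Rightarrow> (real^4) \<times> real)" where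
  "W_phi_proj V = (THE U. U \<in> W_phi \<and> (\<forall>W\<in>W_phi. L2_inner (\<lambda>p. V p - U p) W = 0))"

definition I2_Phi_pi ::
  "(real \<times> real \<Rightarrow> (real^4) \<times> real) \<Rightarrow> (real \<times> real \<Rightarrow> (real^4) \<times> real)" where
  "I2_Phi_pi V = W_phi_proj (generalised_jacobi 1 Phi V)"

definition hessian_E2_Phi ::
  "(real \<times> real \<Rightarrow> (real^4) \<times> real) \<Rightarrow> (real \<times> real \<Rightarrow> (real^4) \<times> real) \<Rightarrow> real" where
  "hessian_E2_Phi V W = L2_inner (I2_Phi_pi V) W"

end

theory Submission
  imports Defs
begin

text \<open>
  A map \<open>F\<close> into the unit sphere satisfies \<open>|\<tau>(F)|\<^sup>2 = |\<Delta>F|\<^sup>2 - (\<Delta>F \<bullet> F)\<^sup>2\<close>, so the second variation of the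
  bienergy can be computed in the ambient space by differentiating under the integral. At \<open>\<Phi>\<close> the
  second-order part of the variation drops out because \<open>\<Delta>\<^sup>2\<Phi> + 4\<Delta>\<Phi> = 0\<close>. For \<open>V = (v, 0)\<close>, with \<open>v\<close>
  tangent along the Clifford torus \<open>c\<close>, the Hessian is the integral of
  \<open>|\<Delta>v|\<^sup>2 - (\<Delta>v \<bullet> c)\<^sup>2 + 4 \<Delta>v \<bullet> v\<close>.
  Let \<open>a\<close>, \<open>b\<close> be the components of \<open>v\<close> tangent to the two circles and \<open>\<surd>2 r\<close> its component normal to
  the torus, and put \<open>w = a\<^sub>\<gamma> - b\<^sub>\<theta>\<close>, \<open>s = a\<^sub>\<theta> + b\<^sub>\<gamma>\<close>, \<open>u = w + 2r\<close> and \<open>L = \<partial>\<^sub>\<gamma>\<^sup>2 + \<partial>\<^sub>\<theta>\<^sup>2\<close>. Up to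
  derivatives of periodic functions the integrand is 16 times
  \<open>2 (Lr - w)\<^sup>2 + |\<nabla>u|\<^sup>2 + |\<nabla>s|\<^sup>2 + s\<^sup>2 + 2 (r\<^sub>\<gamma>\<^sup>2 + a\<^sub>\<gamma>\<^sup>2 + 2 r a\<^sub>\<gamma>) + 2 (r\<^sub>\<theta>\<^sup>2 + b\<^sub>\<theta>\<^sup>2 - 2 r b\<^sub>\<theta>)\<close>,
  and the last two terms have non-negative integrals over each circle by Wirtinger's inequality.
\<close>

section \<open>Calculus of smooth maps\<close>

text \<open>The Jacobi operator and the projection are given by definite descriptions, so nothing
  can be said about the Hessian until each is known to exist and to be unique. Existence comes from
  explicit formulas: a fourth-order expression for the operator and a pointwise projection onto
  sections for the other. Uniqueness of the operator also needs every pair of sections along \<Phi>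
  to be the pair of fields of some two-parameter variation; both cases end with the fact that a
  continuous section of zero \<open>L2_inner\<close> norm vanishes. The positivity estimate has no
  slack. The form is 0 when \<open>a\<close> and \<open>b\<close> are constant and
  \<open>r = 0\<close>, that is, on the rotations of the two circles. Moreover
  \<open>r\<^sub>\<gamma>\<^sup>2 + a\<^sub>\<gamma>\<^sup>2 + 2 r a\<^sub>\<gamma>\<close> is not
  non-negative pointwise: its integral over a circle is that of the isoperimetric inequality for the
  closed plane curve \<open>(r, a)\<close>, with the sharp constant. Wirtinger's inequality is
  obtained without Fourier series, by completing a square with a cotangent on half circles.\<close>

definition ddir :: "'a::euclidean_space \<Rightarrow> ('a \<Rightarrow> 'b::euclidean_space) \<Rightarrow> 'a \<Rightarrow> 'b" where
  "ddir v f = (\<lambda>x. frechet_derivative f (at x) v)"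

lemma ddirI: "(f has_derivative f') (at x) \<Longrightarrow> ddir v f x = f' v"
  unfolding ddir_def using frechet_derivative_at by metis

lemma ddir_has_derivative:
  "f differentiable (at x) \<Longrightarrow> (f has_derivative (\<lambda>v. ddir v f x)) (at x)"
  unfolding ddir_def by (simp add: frechet_derivative_works[symmetric])

lemma Ck_on_SucD:
  assumes "Ck_on (Suc k) f S" "open S"
  shows "x \<in> S \<Longrightarrow> f differentiable (at x)" "Ck_on k (ddir v f) S"
  using assms(1) by (auto simp: differentiable_on_eq_differentiable_at[OF assms(2)] ddir_def)

lemma Ck_on_SucI:
  assumes "open S" "\<And>x. x \<in> S \<Longrightarrow> f differentiable (at x)" "\<And>v. Ck_on k (ddir v f) S"
  shows "Ck_on (Suc k) f S"
  using assms(2,3) by (auto simp: differentiable_on_eq_differentiable_at[OF assms(1)] ddir_def)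

text \<open>On an open set where \<open>f\<close> and \<open>g\<close> agree, both have the same
  derivatives, so the choice made by \<open>frechet_derivative\<close> is the same for both, even at
  a point where no derivative exists.\<close>

lemma ddir_cong:
  assumes "open S" "x \<in> S" "\<And>y. y \<in> S \<Longrightarrow> f y = g y"
  shows "ddir v f x = ddir v g x"
proof -
  have "(f has_derivative f') (at x) \<longleftrightarrow> (g has_derivative f') (at x)" for f'
    using has_derivative_transform_within_open[of f f' x UNIV S g]
      has_derivative_transform_within_open[of g f' x UNIV S f] assms by (metis )
  then show ?thesis unfolding ddir_def frechet_derivative_def by simp
qed

lemma Ck_on_cong:
  assumes "open S" "\<And>y. y \<in> S \<Longrightarrow> f y = g y" "Ck_on k f S"
  shows "Ck_on k g S"
  using assms(2,3)
proof (induction k arbitrary: f g)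
  case 0
  then show ?case using continuous_on_cong[of S S f g] by simp
next
  case (Suc k)
  show ?case
  proof (rule Ck_on_SucI[OF \<open>open S\<close>])
    fix x assume x: "x \<in> S"
    from Ck_on_SucD(1)[OF Suc.prems(2) \<open>open S\<close> x] obtain f' where "(f has_derivative f') (at x)"
      unfolding differentiable_def by blast
    then have "(g has_derivative f') (at x)"
      using has_derivative_transform_within_open[of f f' x UNIV S g] x Suc.prems(1) \<open>open S\<close> by metis
    then show "g differentiable (at x)" unfolding differentiable_def by blast
  next
    fix v
    show "Ck_on k (ddir v g) S"
      by (rule Suc.IH[OF _ Ck_on_SucD(2)[OF Suc.prems(2) \<open>open S\<close>]])
        (use ddir_cong[OF \<open>open S\<close>] Suc.prems(1) in blast)
  qed
qed

lemma Ck_on_Suc_imp: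
  assumes "open S" "Ck_on (Suc k) f S"
  shows "Ck_on k f S"
  using assms(2)
proof (induction k arbitrary: f)
  case 0
  then show ?case by (auto intro: differentiable_imp_continuous_on)
next
  case (Suc k)
  show ?case
    by (rule Ck_on_SucI[OF \<open>open S\<close> Ck_on_SucD(1)[OF Suc.prems \<open>open S\<close>]
        Suc.IH[OF Ck_on_SucD(2)[OF Suc.prems \<open>open S\<close>]]])
qed

lemma Ck_on_subset:
  assumes "Ck_on k f S" "T \<subseteq> S"
  shows "Ck_on k f T"
  using assms
  by (induction k arbitrary: f) (auto intro: continuous_on_subset differentiable_on_subset)

section \<open>Closure properties of the classes C^k\<close>

lemma Ck_on_const: "open S \<Longrightarrow> Ck_on k (\<lambda>x. c) S"
proof (induction k arbitrary: c)
  case (Suc k)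
  have "ddir v (\<lambda>x. c) = (\<lambda>x. 0)" for v :: 'a
    by (simp add: ddir_def)
  then show ?case using Suc by (intro Ck_on_SucI) auto
qed simp

lemma Ck_on_linear:
  assumes "bounded_linear L" "open S"
  shows "Ck_on k L S"
proof (cases k)
  case 0
  then show ?thesis by (simp add: assms linear_continuous_on)
next
  case (Suc m)
  have "ddir v L = (\<lambda>x. L v)" for v
    using ddirI[OF bounded_linear_imp_has_derivative[OF assms(1)]] by blast
  then have "Ck_on (Suc m) L S"
    by (intro Ck_on_SucI[OF assms(2)] bounded_linear_imp_differentiable[OF assms(1)])
      (simp add: Ck_on_const assms(2))
  then show ?thesis using Suc by simp
qed

lemma Ck_on_add:
  assumes "open S" "Ck_on k f S" "Ck_on k g S"
  shows "Ck_on k (\<lambda>x. f x + g x) S"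
  using assms(2,3)
proof (induction k arbitrary: f g)
  case 0
  then show ?case by (auto intro: continuous_intros)
next
  case (Suc k)
  note d = Ck_on_SucD(1)[OF Suc.prems(1) \<open>open S\<close>] Ck_on_SucD(1)[OF Suc.prems(2) \<open>open S\<close>]
  show ?case
  proof (rule Ck_on_SucI[OF \<open>open S\<close>])
    fix v
    show "Ck_on k (ddir v (\<lambda>x. f x + g x)) S"
    proof (rule Ck_on_cong[OF \<open>open S\<close> _ Suc.IH[OF Ck_on_SucD(2)[OF Suc.prems(1) \<open>open S\<close>, of v]
            Ck_on_SucD(2)[OF Suc.prems(2) \<open>open S\<close>, of v]]])
      fix y assume "y \<in> S"
      then show "ddir v f y + ddir v g y = ddir v (\<lambda>x. f x + g x) y"
        using ddirI[OF has_derivative_add[OF ddir_has_derivative ddir_has_derivative]] d by fastforce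
    qed
  qed (use d in auto)
qed

text \<open>One statement serves scalar multiples, inner products and real products. The product
  rule leaves one factor undifferentiated, which must be lowered from order \<open>Suc k\<close> to
  \<open>k\<close>; this is what \<open>Ck_on_Suc_imp\<close> is for.\<close>

lemma Ck_on_bilinear:
  assumes "bounded_bilinear h" "open S" "Ck_on k f S" "Ck_on k g S"
  shows "Ck_on k (\<lambda>x. h (f x) (g x)) S"
  using assms(3,4)
proof (induction k arbitrary: f g)
  case 0
  then show ?case by (simp add: bounded_bilinear.continuous_on[OF assms(1)])
next
  case (Suc k)
  note d = Ck_on_SucD(1)[OF Suc.prems(1) \<open>open S\<close>] Ck_on_SucD(1)[OF Suc.prems(2) \<open>open S\<close>]
  have D: "((\<lambda>x. h (f x) (g x)) has_derivative
      (\<lambda>v. h (f x) (ddir v g x) + h (ddir v f x) (g x))) (at x)" if "x \<in> S" for x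
    by (intro bounded_bilinear.FDERIV[OF assms(1)] ddir_has_derivative d that)
  show ?case
  proof (rule Ck_on_SucI[OF \<open>open S\<close>])
    fix x assume "x \<in> S"
    then show "(\<lambda>x. h (f x) (g x)) differentiable (at x)"
      using D unfolding differentiable_def by blast
  next
    fix v
    have "Ck_on k (\<lambda>x. h (f x) (ddir v g x) + h (ddir v f x) (g x)) S"
      by (intro Ck_on_add[OF \<open>open S\<close>] Suc.IH Ck_on_Suc_imp[OF \<open>open S\<close> Suc.prems(1)]
          Ck_on_Suc_imp[OF \<open>open S\<close> Suc.prems(2)] Ck_on_SucD(2)[OF Suc.prems(1) \<open>open S\<close>]
          Ck_on_SucD(2)[OF Suc.prems(2) \<open>open S\<close>])
    then show "Ck_on k (ddir v (\<lambda>x. h (f x) (g x))) S"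
      by (rule Ck_on_cong[OF \<open>open S\<close>, rotated]) (use ddirI[OF D] in auto)
  qed
qed

lemma Ck_on_sum:
  assumes "open S" "\<And>i. i \<in> I \<Longrightarrow> Ck_on k (f i) S"
  shows "Ck_on k (\<lambda>x. \<Sum>i\<in>I. f i x) S"
  using assms(2)
  by (induction I rule: infinite_finite_induct) (simp_all add: Ck_on_const Ck_on_add assms(1))

text \<open>\<open>Ck_on\<close> speaks of derivatives in fixed directions, but the chain rule
  differentiates \<open>g\<close> in the direction \<open>ddir v f x\<close>, which moves with
  \<open>x\<close>. Expanding in the basis leaves fixed directions with variable coefficients, to
  which sums, products and the induction hypothesis apply.\<close>

lemma ddir_compose:
  assumes "f differentiable (at x)" "g differentiable (at (f x))"
  shows "ddir v (\<lambda>x. g (f x)) x = (\<Sum>b\<in>Basis. (ddir v f x \<bullet> b) *\<^sub>R ddir b g (f x))"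
proof -
  let ?G = "\<lambda>w. ddir w g (f x)"
  have G: "(g has_derivative ?G) (at (f x))" by (rule ddir_has_derivative[OF assms(2)])
  have lin: "linear ?G" using has_derivative_bounded_linear[OF G] by (rule bounded_linear.linear)
  have "((\<lambda>x. g (f x)) has_derivative (\<lambda>v. ?G (ddir v f x))) (at x)"
    using has_derivative_compose[OF ddir_has_derivative[OF assms(1)] G] .
  then have "ddir v (\<lambda>x. g (f x)) x = ?G (ddir v f x)" by (rule ddirI)
  also have "\<dots> = ?G (\<Sum>b\<in>Basis. (ddir v f x \<bullet> b) *\<^sub>R b)" by (simp add: euclidean_representation)
  also have "\<dots> = (\<Sum>b\<in>Basis. (ddir v f x \<bullet> b) *\<^sub>R ?G b)"
    by (simp add: linear_sum[OF lin] linear_cmul[OF lin])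
  finally show ?thesis .
qed

lemma Ck_on_compose:
  assumes "open S" "open T" "f ` S \<subseteq> T" "Ck_on k f S" "Ck_on k g T"
  shows "Ck_on k (\<lambda>x. g (f x)) S"
  using assms(4,5)
proof (induction k arbitrary: g)
  case 0
  then show ?case using assms(3) by (auto intro: continuous_on_compose2)
next
  case (Suc k)
  have d: "f differentiable (at x)" "g differentiable (at (f x))" if "x \<in> S" for x
    using Ck_on_SucD(1)[OF Suc.prems(1) \<open>open S\<close> that]
      Ck_on_SucD(1)[OF Suc.prems(2) \<open>open T\<close>, of "f x"] assms(3) that by auto
  show ?case
  proof (rule Ck_on_SucI[OF \<open>open S\<close>])
    fix x assume "x \<in> S"
    then show "(\<lambda>x. g (f x)) differentiable (at x)"
      using d differentiable_chain_at[of f x g] by (auto simp: o_def)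
  next
    fix v
    have "Ck_on k (\<lambda>x. \<Sum>b\<in>Basis. (ddir v f x \<bullet> b) *\<^sub>R ddir b g (f x)) S"
      by (intro Ck_on_sum \<open>open S\<close> Ck_on_bilinear[OF bounded_bilinear_scaleR]
          Ck_on_bilinear[OF bounded_bilinear_inner] Ck_on_const
          Ck_on_SucD(2)[OF Suc.prems(1)] Suc.IH Ck_on_SucD(2)[OF Suc.prems(2) \<open>open T\<close>]
          Ck_on_Suc_imp[OF _ Suc.prems(1)])
    then show "Ck_on k (ddir v (\<lambda>x. g (f x))) S"
      by (rule Ck_on_cong[OF \<open>open S\<close>, rotated]) (simp add: ddir_compose d)
  qed
qed

lemma smooth_map_on_subset: "smooth_map_on f S \<Longrightarrow> T \<subseteq> S \<Longrightarrow> smooth_map_on f T"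
  unfolding smooth_map_on_def using Ck_on_subset by blast

lemma smooth_map_on_differentiable:
  "smooth_map_on f S \<Longrightarrow> open S \<Longrightarrow> x \<in> S \<Longrightarrow> f differentiable (at x)"
  unfolding smooth_map_on_def using Ck_on_SucD(1) by blast

lemma smooth_map_on_has_derivative:
  "smooth_map_on f S \<Longrightarrow> open S \<Longrightarrow> x \<in> S \<Longrightarrow> (f has_derivative (\<lambda>v. ddir v f x)) (at x)"
  by (simp add: ddir_has_derivative smooth_map_on_differentiable)

lemma smooth_map_on_continuous: "smooth_map_on f S \<Longrightarrow> continuous_on S f"
  unfolding smooth_map_on_def by (metis Ck_on.simps(1))

named_theorems smooth_intros

lemma smooth_ddir [smooth_intros]: "open S \<Longrightarrow> smooth_map_on f S \<Longrightarrow> smooth_map_on (ddir v f) S"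
  unfolding smooth_map_on_def using Ck_on_SucD(2) by blast

lemma smooth_const [smooth_intros]: "open S \<Longrightarrow> smooth_map_on (\<lambda>x. c) S"
  unfolding smooth_map_on_def by (simp add: Ck_on_const)

lemma smooth_linear: "open S \<Longrightarrow> bounded_linear L \<Longrightarrow> smooth_map_on L S"
  unfolding smooth_map_on_def by (simp add: Ck_on_linear)

lemma smooth_add [smooth_intros]:
  "open S \<Longrightarrow> smooth_map_on f S \<Longrightarrow> smooth_map_on g S \<Longrightarrow> smooth_map_on (\<lambda>x. f x + g x) S"
  unfolding smooth_map_on_def by (simp add: Ck_on_add)

lemma smooth_bilinear:
  "bounded_bilinear h \<Longrightarrow> open S \<Longrightarrow> smooth_map_on f S \<Longrightarrow> smooth_map_on g S \<Longrightarrow>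
    smooth_map_on (\<lambda>x. h (f x) (g x)) S"
  unfolding smooth_map_on_def by (simp add: Ck_on_bilinear)

lemmas smooth_scaleR [smooth_intros] = smooth_bilinear[OF bounded_bilinear_scaleR]
lemmas smooth_inner [smooth_intros] = smooth_bilinear[OF bounded_bilinear_inner]

lemma smooth_mult [smooth_intros]:
  fixes f g :: "'a::euclidean_space \<Rightarrow> real"
  shows "open S \<Longrightarrow> smooth_map_on f S \<Longrightarrow> smooth_map_on g S \<Longrightarrow> smooth_map_on (\<lambda>x. f x * g x) S"
  by (rule smooth_bilinear[OF bounded_bilinear_mult])

lemma smooth_compose:
  "open S \<Longrightarrow> open T \<Longrightarrow> f ` S \<subseteq> T \<Longrightarrow> smooth_map_on f S \<Longrightarrow> smooth_map_on g T \<Longrightarrow>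
    smooth_map_on (\<lambda>x. g (f x)) S"
  unfolding smooth_map_on_def by (simp add: Ck_on_compose)

lemma smooth_linear_compose:
  "bounded_linear L \<Longrightarrow> open S \<Longrightarrow> smooth_map_on f S \<Longrightarrow> smooth_map_on (\<lambda>x. L (f x)) S"
  using smooth_compose[of S UNIV f L] by (simp add: smooth_linear)

lemma smooth_minus [smooth_intros]:
  "open S \<Longrightarrow> smooth_map_on f S \<Longrightarrow> smooth_map_on (\<lambda>x. - f x) S"
  by (rule smooth_linear_compose[OF bounded_linear_minus[OF bounded_linear_ident]])

lemma smooth_diff [smooth_intros]:
  "open S \<Longrightarrow> smooth_map_on f S \<Longrightarrow> smooth_map_on g S \<Longrightarrow> smooth_map_on (\<lambda>x. f x - g x) S"
  using smooth_add[OF _ _ smooth_minus, of S f g] by simp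

lemma smooth_divide_const [smooth_intros]:
  fixes f :: "'a::euclidean_space \<Rightarrow> real"
  shows "open S \<Longrightarrow> smooth_map_on f S \<Longrightarrow> smooth_map_on (\<lambda>x. f x / c) S"
  using smooth_mult[OF _ _ smooth_const, of S f "inverse c"] by (simp add: field_simps)

lemma smooth_fst [smooth_intros]: "open S \<Longrightarrow> smooth_map_on f S \<Longrightarrow> smooth_map_on (\<lambda>x. fst (f x)) S"
  by (rule smooth_linear_compose[OF bounded_linear_fst])

lemma smooth_snd [smooth_intros]: "open S \<Longrightarrow> smooth_map_on f S \<Longrightarrow> smooth_map_on (\<lambda>x. snd (f x)) S"
  by (rule smooth_linear_compose[OF bounded_linear_snd])

lemma smooth_ident [smooth_intros]: "open S \<Longrightarrow> smooth_map_on (\<lambda>x. x) S"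
  by (rule smooth_linear[OF _ bounded_linear_ident])

lemma smooth_Pair [smooth_intros]:
  assumes "open S" "smooth_map_on f S" "smooth_map_on g S"
  shows "smooth_map_on (\<lambda>x. (f x, g x)) S"
proof -
  have "smooth_map_on (\<lambda>x. (f x, 0) + (0, g x)) S"
    by (intro smooth_add assms smooth_linear_compose[OF bounded_linear_Pair[OF bounded_linear_ident bounded_linear_zero]]
        smooth_linear_compose[OF bounded_linear_Pair[OF bounded_linear_zero bounded_linear_ident]])
  then show ?thesis by simp
qed

lemma ddir_real: "(f has_real_derivative d) (at x) \<Longrightarrow> ddir v f x = d * v"
  by (rule ddirI[where f' = "(*) d"]) (simp add: has_field_derivative_def)

lemma Ck_on_real:
  fixes f f' :: "real \<Rightarrow> real"
  assumes "open S" "\<And>x. x \<in> S \<Longrightarrow> (f has_real_derivative f' x) (at x)" "Ck_on k f' S"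
  shows "Ck_on (Suc k) f S"
proof (rule Ck_on_SucI[OF assms(1)])
  fix v
  show "Ck_on k (ddir v f) S"
    by (rule Ck_on_cong[OF assms(1) _ Ck_on_bilinear[OF bounded_bilinear_mult assms(1,3)
          Ck_on_const[OF assms(1), of _ v]]])
      (simp add: ddir_real[OF assms(2)])
qed (use assms(2) real_differentiable_def in blast)

lemma smooth_sin_cos: "smooth_map_on sin (UNIV :: real set) \<and> smooth_map_on cos (UNIV :: real set)"
proof -
  \<comment> \<open>The span of sine and cosine is closed under differentiation, so the induction
    runs over all coefficients at once.\<close>
  have "Ck_on k (\<lambda>x. c * sin x + d * cos x) (UNIV :: real set)" for k and c d :: real
  proof (induction k arbitrary: c d)
    case 0
    show ?case by (auto intro!: continuous_intros)
  next
    case (Suc k)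
    have "((\<lambda>x. c * sin x + d * cos x) has_real_derivative (- d) * sin x + c * cos x) (at x)" for x
      by (auto intro!: derivative_eq_intros)
    then show ?case by (intro Ck_on_real[OF _ _ Suc.IH[of "- d" c]]) auto
  qed
  from this[of _ 1 0] this[of _ 0 1] show ?thesis unfolding smooth_map_on_def by simp
qed

lemma smooth_sin [smooth_intros]:
  "open S \<Longrightarrow> smooth_map_on f S \<Longrightarrow> smooth_map_on (\<lambda>x. sin (f x :: real)) S"
  using smooth_compose[of S UNIV f sin] smooth_sin_cos by simp

lemma smooth_cos [smooth_intros]:
  "open S \<Longrightarrow> smooth_map_on f S \<Longrightarrow> smooth_map_on (\<lambda>x. cos (f x :: real)) S"
  using smooth_compose[of S UNIV f cos] smooth_sin_cos by simp

lemma smooth_powr: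
  fixes f :: "'a::euclidean_space \<Rightarrow> real"
  assumes "open S" "smooth_map_on f S" "\<And>x. x \<in> S \<Longrightarrow> 0 < f x"
  shows "smooth_map_on (\<lambda>x. f x powr a) S"
proof -
  \<comment> \<open>Differentiating lowers the exponent by one, hence the induction with arbitrary
    \<open>a\<close>.\<close>
  have "Ck_on k (\<lambda>x. x powr a) {0<..}" for k and a :: real
  proof (induction k arbitrary: a)
    case 0
    show ?case by (auto intro!: continuous_intros)
  next
    case (Suc k)
    have "((\<lambda>x. x powr a) has_real_derivative a * x powr (a - 1)) (at x)" if "x \<in> {0<..}" for x
      using that has_real_derivative_powr by simp
    moreover have "Ck_on k (\<lambda>x. a * x powr (a - 1)) {0<..}"
      by (rule Ck_on_bilinear[OF bounded_bilinear_mult _ Ck_on_const Suc.IH]) auto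
    ultimately show ?case by (intro Ck_on_real) auto
  qed
  then have "smooth_map_on (\<lambda>x. x powr a) {0<..}" by (simp add: smooth_map_on_def)
  from smooth_compose[OF assms(1) _ _ assms(2) this] assms(3) show ?thesis by fastforce
qed

section \<open>Symmetry of mixed second derivatives\<close>

lemma second_difference_mvt:
  fixes f :: "'a::euclidean_space \<Rightarrow> real"
  assumes S: "open S" and f: "smooth_map_on f S" and h: "h > 0"
    and sub: "\<And>x y. 0 \<le> x \<Longrightarrow> x \<le> h \<Longrightarrow> 0 \<le> y \<Longrightarrow> y \<le> h \<Longrightarrow> p + x *\<^sub>R u + y *\<^sub>R w \<in> S"
  obtains x y where "0 \<le> x" "x \<le> h" "0 \<le> y" "y \<le> h"
    "f (p + h *\<^sub>R u + h *\<^sub>R w) - f (p + h *\<^sub>R u) - f (p + h *\<^sub>R w) + f p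
       = h * (h * ddir w (ddir u f) (p + x *\<^sub>R u + y *\<^sub>R w))"
proof -
  have line: "((\<lambda>t. g (q + t *\<^sub>R v)) has_real_derivative ddir v g (q + t *\<^sub>R v)) (at t)"
    if "smooth_map_on g S" "q + t *\<^sub>R v \<in> S" for g :: "'a \<Rightarrow> real" and q v t
  proof -
    have "((\<lambda>t. q + t *\<^sub>R v) has_derivative (\<lambda>s. s *\<^sub>R v)) (at t)"
      by (auto intro!: derivative_eq_intros)
    from has_derivative_compose[OF this smooth_map_on_has_derivative[OF that(1) S that(2)]]
    have "((\<lambda>t. g (q + t *\<^sub>R v)) has_derivative (\<lambda>s. ddir (s *\<^sub>R v) g (q + t *\<^sub>R v))) (at t)" .
    moreover have "linear (\<lambda>v. ddir v g (q + t *\<^sub>R v0))" if "q + t *\<^sub>R v0 \<in> S" for v0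
      using smooth_map_on_has_derivative[OF \<open>smooth_map_on g S\<close> S that]
        has_derivative_bounded_linear bounded_linear.linear by blast
    ultimately show ?thesis
      using that linear_cmul[of "\<lambda>w. ddir w g (q + t *\<^sub>R v)"]
      by (simp add: has_field_derivative_def mult.commute[of _ "ddir v g (q + t *\<^sub>R v)"])
  qed
  \<comment> \<open>The second difference is \<open>\<phi> h - \<phi> 0\<close>. The mean value
    theorem along \<open>u\<close>, and then along \<open>w\<close>, turns it into a mixed second
    derivative at an intermediate point.\<close>
  define \<phi> where "\<phi> x = f ((p + h *\<^sub>R w) + x *\<^sub>R u) - f (p + x *\<^sub>R u)" for x
  have *: "(p + h *\<^sub>R w) + x *\<^sub>R u \<in> S" "p + x *\<^sub>R u \<in> S" if "0 \<le> x" "x \<le> h" for x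
    using sub[of x h] sub[of x 0] that h by (simp_all add: add_ac)
  have "\<exists>z>0. z < h \<and> \<phi> h - \<phi> 0
      = (h - 0) * (ddir u f ((p + h *\<^sub>R w) + z *\<^sub>R u) - ddir u f (p + z *\<^sub>R u))"
    unfolding \<phi>_def by (rule MVT2[OF h]) (intro DERIV_diff line f *; simp)
  then obtain x where x: "0 < x" "x < h" and
    e1: "\<phi> h - \<phi> 0 = h * (ddir u f ((p + x *\<^sub>R u) + h *\<^sub>R w) - ddir u f (p + x *\<^sub>R u + 0 *\<^sub>R w))"
    by (auto simp: algebra_simps)
  have "\<exists>z>0. z < h \<and> ddir u f ((p + x *\<^sub>R u) + h *\<^sub>R w) - ddir u f (p + x *\<^sub>R u + 0 *\<^sub>R w)
      = (h - 0) * ddir w (ddir u f) ((p + x *\<^sub>R u) + z *\<^sub>R w)"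
    by (rule MVT2[OF h]) (intro line smooth_ddir S f sub; use x in simp)
  then obtain y where y: "0 < y" "y < h" and
    e2: "ddir u f ((p + x *\<^sub>R u) + h *\<^sub>R w) - ddir u f (p + x *\<^sub>R u + 0 *\<^sub>R w)
      = h * ddir w (ddir u f) ((p + x *\<^sub>R u) + y *\<^sub>R w)" by auto
  show thesis
    by (rule that[of x y]) (use x y e1 e2 in \<open>auto simp: \<phi>_def add_ac\<close>)
qed

text \<open>The second difference over the parallelogram spanned by \<open>h u\<close> and
  \<open>h w\<close> does not depend on the order of \<open>u\<close> and \<open>w\<close>, so both
  mixed derivatives take the same value, at two points close to \<open>p\<close>. Continuity carries
  the equality to \<open>p\<close>.\<close>

lemma ddir_commute_real:
  fixes f :: "'a::euclidean_space \<Rightarrow> real"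
  assumes S: "open S" and f: "smooth_map_on f S" and p: "p \<in> S"
  shows "ddir u (ddir w f) p = ddir w (ddir u f) p"
proof -
  let ?A = "ddir u (ddir w f)" and ?B = "ddir w (ddir u f)"
  have "dist (?A p) (?B p) \<le> e" if "e > 0" for e
  proof -
    have "continuous_on S ?A" "continuous_on S ?B"
      by (intro smooth_map_on_continuous smooth_ddir S f)+
    then have cont: "isCont ?A p" "isCont ?B p"
      using p by (simp_all add: continuous_on_eq_continuous_at[OF S])
    have e2: "e / 2 > 0" using that by simp
    obtain d1 where d1: "d1 > 0" "\<And>q. dist q p < d1 \<Longrightarrow> dist (?A q) (?A p) < e / 2"
      using cont(1) e2 unfolding continuous_at_eps_delta by blast
    obtain d2 where d2: "d2 > 0" "\<And>q. dist q p < d2 \<Longrightarrow> dist (?B q) (?B p) < e / 2"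
      using cont(2) e2 unfolding continuous_at_eps_delta by blast
    note d = d1 d2
    obtain d0 where d0: "d0 > 0" "ball p d0 \<subseteq> S" using S p openE by blast
    define r where "r = Min {d0, d1, d2}"
    have r: "r > 0" "r \<le> d0" "r \<le> d1" "r \<le> d2" using d d0 by (auto simp: r_def)
    \<comment> \<open>With \<open>h * N = r / 2\<close> the whole parallelogram lies within distance
      \<open>r\<close> of \<open>p\<close>; the summand 1 keeps \<open>N\<close> positive when
      \<open>u\<close> and \<open>w\<close> both vanish.\<close>
    define N where "N = norm u + norm w + 1"
    define h where "h = r / (2 * N)"
    have "N > 0" unfolding N_def using norm_ge_zero[of u] norm_ge_zero[of w] by linarith
    then have "h > 0" "h * N = r / 2" using r by (auto simp: h_def)
    then have h: "h > 0" "h * (norm u + norm w + 1) = r / 2" by (simp_all add: N_def)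
    have near: "dist (p + x *\<^sub>R a + y *\<^sub>R b) p < r"
      if "0 \<le> x" "x \<le> h" "0 \<le> y" "y \<le> h" "norm a + norm b \<le> norm u + norm w + 1" for x y a b
    proof -
      have "dist (p + x *\<^sub>R a + y *\<^sub>R b) p \<le> norm (x *\<^sub>R a) + norm (y *\<^sub>R b)"
        using norm_triangle_ineq[of "x *\<^sub>R a" "y *\<^sub>R b"] by (simp add: dist_norm add.assoc)
      also have "\<dots> \<le> h * norm a + h * norm b"
        using that by (intro add_mono) (auto intro: mult_right_mono)
      also have "\<dots> \<le> h * (norm u + norm w + 1)"
        using that h by (simp flip: distrib_left)
      also have "\<dots> < r" using h r by simp
      finally show ?thesis .
    qed
    have in_S: "p + x *\<^sub>R a + y *\<^sub>R b \<in> S"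
      if "0 \<le> x" "x \<le> h" "0 \<le> y" "y \<le> h" "norm a + norm b \<le> norm u + norm w + 1" for x y a b
      using near[OF that] d0 r by (auto simp: dist_commute)
    obtain x y where xy: "0 \<le> x" "x \<le> h" "0 \<le> y" "y \<le> h"
      and 1: "f (p + h *\<^sub>R u + h *\<^sub>R w) - f (p + h *\<^sub>R u) - f (p + h *\<^sub>R w) + f p
         = h * (h * ?B (p + x *\<^sub>R u + y *\<^sub>R w))"
      by (rule second_difference_mvt[OF S f h(1), of p u w]) (use in_S in auto)
    obtain x' y' where xy': "0 \<le> x'" "x' \<le> h" "0 \<le> y'" "y' \<le> h"
      and 2: "f (p + h *\<^sub>R w + h *\<^sub>R u) - f (p + h *\<^sub>R w) - f (p + h *\<^sub>R u) + f p
         = h * (h * ?A (p + x' *\<^sub>R w + y' *\<^sub>R u))"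
      by (rule second_difference_mvt[OF S f h(1), of p w u]) (use in_S in \<open>auto simp: add_ac\<close>)
    have "h * (h * ?B (p + x *\<^sub>R u + y *\<^sub>R w)) = h * (h * ?A (p + x' *\<^sub>R w + y' *\<^sub>R u))"
      using 1 2 by (simp add: add_ac algebra_simps)
    then have eq: "?B (p + x *\<^sub>R u + y *\<^sub>R w) = ?A (p + x' *\<^sub>R w + y' *\<^sub>R u)" using h by simp
    have "dist (?B (p + x *\<^sub>R u + y *\<^sub>R w)) (?B p) < e / 2"
      by (rule d(4)) (use near[OF xy, of u w] r in auto)
    moreover have "dist (?A (p + x' *\<^sub>R w + y' *\<^sub>R u)) (?A p) < e / 2"
      by (rule d(2)) (use near[OF xy', of w u] r in auto)
    ultimately show ?thesis
      using eq dist_triangle_half_l[of "?A p" "?A (p + x' *\<^sub>R w + y' *\<^sub>R u)" e "?B p"]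
      by (simp add: dist_commute)
  qed
  then show ?thesis using field_le_epsilon[of "dist (?A p) (?B p)" 0] by simp
qed

lemma ddir_inner_const:
  assumes "f differentiable (at x)"
  shows "ddir v (\<lambda>x. f x \<bullet> b) x = ddir v f x \<bullet> b"
  by (rule ddirI[OF has_derivative_inner_left[OF ddir_has_derivative[OF assms]]])

text \<open>Reduced to components, since the mean value theorem is available only for real
  functions.\<close>

lemma ddir_commute:
  assumes S: "open S" and f: "smooth_map_on f S" and p: "p \<in> S"
  shows "ddir u (ddir w f) p = ddir w (ddir u f) p"
proof (rule euclidean_eqI)
  fix b :: 'b
  have *: "ddir u (ddir w f) p \<bullet> b = ddir u (ddir w (\<lambda>x. f x \<bullet> b)) p" for u w
  proof -
    have "ddir u (ddir w f) p \<bullet> b = ddir u (\<lambda>x. ddir w f x \<bullet> b) p"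
      using S f p by (intro ddir_inner_const[symmetric] smooth_map_on_differentiable[of _ S] smooth_ddir)
    also have "\<dots> = ddir u (ddir w (\<lambda>x. f x \<bullet> b)) p"
      by (rule ddir_cong[OF S p]) (simp add: ddir_inner_const smooth_map_on_differentiable[OF f S])
    finally show ?thesis .
  qed
  show "ddir u (ddir w f) p \<bullet> b = ddir w (ddir u f) p \<bullet> b"
    unfolding * by (rule ddir_commute_real[OF S _ p]) (intro smooth_intros S f)
qed

lemma ddir_add:
  "f differentiable (at x) \<Longrightarrow> g differentiable (at x) \<Longrightarrow>
    ddir v (\<lambda>x. f x + g x) x = ddir v f x + ddir v g x"
  by (rule ddirI[OF has_derivative_add[OF ddir_has_derivative ddir_has_derivative]])

lemma ddir_diff:
  "f differentiable (at x) \<Longrightarrow> g differentiable (at x) \<Longrightarrow>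
    ddir v (\<lambda>x. f x - g x) x = ddir v f x - ddir v g x"
  by (rule ddirI[OF has_derivative_diff[OF ddir_has_derivative ddir_has_derivative]])

lemma ddir_bilinear:
  assumes "bounded_bilinear h" "f differentiable (at x)" "g differentiable (at x)"
  shows "ddir v (\<lambda>x. h (f x) (g x)) x = h (f x) (ddir v g x) + h (ddir v f x) (g x)"
  by (rule ddirI[OF bounded_bilinear.FDERIV[OF assms(1) ddir_has_derivative ddir_has_derivative]])
    (use assms in auto)

lemmas ddir_inner = ddir_bilinear[OF bounded_bilinear_inner]

lemma ddir_linear_compose:
  assumes "bounded_linear L" "f differentiable (at x)"
  shows "ddir v (\<lambda>x. L (f x)) x = L (ddir v f x)"
  by (rule ddirI[OF bounded_linear.has_derivative[OF assms(1) ddir_has_derivative[OF assms(2)]]])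

lemma ddir_affine_compose:
  assumes "bounded_linear L" "f differentiable (at (c + L x))"
  shows "ddir v (\<lambda>x. f (c + L x)) x = ddir (L v) f (c + L x)"
proof (rule ddirI)
  have "((\<lambda>x. c + L x) has_derivative L) (at x)"
    using bounded_linear_imp_has_derivative[OF assms(1)] by (auto intro!: derivative_eq_intros)
  from has_derivative_compose[OF this ddir_has_derivative[OF assms(2)]]
  show "((\<lambda>x. f (c + L x)) has_derivative (\<lambda>v. ddir (L v) f (c + L x))) (at x)" .
qed

lemma linear_ddir: "f differentiable (at x) \<Longrightarrow> linear (\<lambda>v. ddir v f x)"
  unfolding ddir_def by (rule linear_frechet_derivative)

lemma smooth_map_on_UNIV_differentiable: "smooth_map_on f UNIV \<Longrightarrow> f differentiable (at x)"
  by (rule smooth_map_on_differentiable) auto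

section \<open>Analysis on the torus\<close>

lemma torus_periodic_ddir:
  assumes f: "smooth_map_on f UNIV" and per: "torus_periodic f"
  shows "torus_periodic (ddir v f)"
proof -
  have *: "ddir v f (q + c) = ddir v f q" if "\<And>p. f (p + c) = f p" for c q :: "real \<times> real"
  proof -
    have "ddir v (\<lambda>p. f (c + p)) q = ddir v f (c + q)"
      by (rule ddir_affine_compose[OF bounded_linear_ident smooth_map_on_UNIV_differentiable[OF f]])
    moreover have "(\<lambda>p. f (c + p)) = f" using that by (simp add: add.commute)
    ultimately show ?thesis by (simp add: add.commute)
  qed
  show ?thesis
    using per *[of "(2 * pi, 0)"] *[of "(0, 2 * pi)"] unfolding torus_periodic_def by auto
qed

text \<open>The trace Laplacian of the torus metric, taken in the ambient vector space. The frame
  vectors have coordinate length 2, so it is four times the flat Laplacian in the angles.\<close>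

definition laplacian :: "(real \<times> real \<Rightarrow> 'b::euclidean_space) \<Rightarrow> real \<times> real \<Rightarrow> 'b" where
  "laplacian f p = (\<Sum>e\<in>torus_frame. ddir e (ddir e f) p)"

lemma finite_torus_frame: "finite torus_frame"
  by (simp add: torus_frame_def)

lemma smooth_sum [smooth_intros]:
  "open S \<Longrightarrow> (\<And>i. i \<in> I \<Longrightarrow> smooth_map_on (f i) S) \<Longrightarrow> smooth_map_on (\<lambda>x. \<Sum>i\<in>I. f i x) S"
  unfolding smooth_map_on_def by (simp add: Ck_on_sum)

lemma smooth_laplacian [smooth_intros]:
  assumes "smooth_map_on f UNIV"
  shows "smooth_map_on (laplacian f) UNIV"
proof -
  have "laplacian f = (\<lambda>p. \<Sum>e\<in>torus_frame. ddir e (ddir e f) p)"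
    by (simp add: laplacian_def fun_eq_iff)
  then show ?thesis by (simp add: smooth_sum smooth_ddir assms)
qed

lemma torus_periodic_laplacian:
  assumes "smooth_map_on f UNIV" "torus_periodic f"
  shows "torus_periodic (laplacian f)"
  using torus_periodic_ddir[OF smooth_ddir[OF open_UNIV assms(1)] torus_periodic_ddir[OF assms]]
  unfolding torus_periodic_def laplacian_def by simp

section \<open>Integration over the torus\<close>

abbreviation torus_box :: "(real \<times> real) set" where
  "torus_box \<equiv> cbox (0, 0) (2 * pi, 2 * pi)"

lemma torus_integrable:
  fixes f :: "real \<times> real \<Rightarrow> real"
  assumes "smooth_map_on f UNIV"
  shows "(\<lambda>p. f p / 4) integrable_on torus_box"
  by (intro integrable_continuous continuous_on_subset[OF smooth_map_on_continuous[of _ UNIV]]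
      smooth_divide_const assms subset_UNIV open_UNIV)

lemma torus_integral_add:
  assumes "smooth_map_on f UNIV" "smooth_map_on g UNIV"
  shows "torus_integral (\<lambda>p. f p + g p) = torus_integral f + torus_integral g"
  unfolding torus_integral_def add_divide_distrib
  by (rule Henstock_Kurzweil_Integration.integral_add[OF torus_integrable torus_integrable]) fact+

lemma torus_integral_diff:
  assumes "smooth_map_on f UNIV" "smooth_map_on g UNIV"
  shows "torus_integral (\<lambda>p. f p - g p) = torus_integral f - torus_integral g"
  unfolding torus_integral_def diff_divide_distrib
  by (rule Henstock_Kurzweil_Integration.integral_diff[OF torus_integrable torus_integrable]) fact+

lemma torus_integral_cmult: "torus_integral (\<lambda>p. c * f p) = c * torus_integral f"
  unfolding torus_integral_def
  using integral_mult_right[of torus_box c "\<lambda>p. f p / 4"] by simp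

lemma torus_integral_nonneg:
  assumes "smooth_map_on f UNIV" "\<And>p. 0 \<le> f p"
  shows "0 \<le> torus_integral f"
  unfolding torus_integral_def
  by (rule integral_nonneg[OF torus_integrable[OF assms(1)]]) (simp add: assms(2))

text \<open>Both orders are kept, together with the integrability of the inner integrals: a
  derivative or an inequality along one coordinate circle requires the integration over that circle
  to be the inner one.\<close>

lemma torus_integral_iterated:
  assumes "continuous_on UNIV f"
  shows "torus_integral f = integral {0..2*pi} (\<lambda>x. integral {0..2*pi} (\<lambda>y. f (x, y))) / 4"
    and "torus_integral f = integral {0..2*pi} (\<lambda>y. integral {0..2*pi} (\<lambda>x. f (x, y))) / 4"
    and "(\<lambda>x. integral {0..2*pi} (\<lambda>y. f (x, y))) integrable_on {0..2*pi}"
    and "(\<lambda>y. integral {0..2*pi} (\<lambda>x. f (x, y))) integrable_on {0..2*pi}"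
proof -
  have c: "continuous_on torus_box f" using assms continuous_on_subset by blast
  have "torus_integral f = integral torus_box f / 4" by (simp add: torus_integral_def)
  also have "integral torus_box f = integral {0..2*pi} (\<lambda>x. integral {0..2*pi} (\<lambda>y. f (x, y)))"
    using integral_prod_continuous[OF c] by simp
  finally show 1: "torus_integral f = integral {0..2*pi} (\<lambda>x. integral {0..2*pi} (\<lambda>y. f (x, y))) / 4" .
  have "continuous_on torus_box (\<lambda>(x, y). f (x, y))" using c by simp
  from integral_swap_continuous[OF this]
  show "torus_integral f = integral {0..2*pi} (\<lambda>y. integral {0..2*pi} (\<lambda>x. f (x, y))) / 4"
    using 1 by simp
  show "(\<lambda>x. integral {0..2*pi} (\<lambda>y. f (x, y))) integrable_on {0..2*pi}"
    using integral_integrable_2dim[OF c] by simp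
  have "continuous_on UNIV (\<lambda>p. f (snd p, fst p))"
    by (rule continuous_on_compose2[OF assms]) (auto intro!: continuous_intros)
  then have "continuous_on torus_box (\<lambda>p. f (snd p, fst p))" using continuous_on_subset by blast
  from integral_integrable_2dim[OF this]
  show "(\<lambda>y. integral {0..2*pi} (\<lambda>x. f (x, y))) integrable_on {0..2*pi}" by simp
qed

lemma line_derivative:
  fixes f :: "real \<times> real \<Rightarrow> real"
  assumes f: "smooth_map_on f UNIV"
  shows "((\<lambda>x. f (x, y)) has_real_derivative ddir (1, 0) f (x, y)) (at x)"
    and "((\<lambda>y. f (x, y)) has_real_derivative ddir (0, 1) f (x, y)) (at y)"
proof -
  have D: "(f has_derivative (\<lambda>v. ddir v f p)) (at p)" for p
    by (rule smooth_map_on_has_derivative[OF f]) auto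
  have lin: "(\<lambda>h. ddir (h, 0) f p) = (*) (ddir (1, 0) f p)" "(\<lambda>h. ddir (0, h) f p) = (*) (ddir (0, 1) f p)" for p
  proof -
    have *: "ddir (h *\<^sub>R v) f p = h *\<^sub>R ddir v f p" for h v
      by (rule linear_cmul[OF linear_ddir[OF smooth_map_on_UNIV_differentiable[OF f]]])
    show "(\<lambda>h. ddir (h, 0) f p) = (*) (ddir (1, 0) f p)"
    proof
      fix h show "ddir (h, 0) f p = ddir (1, 0) f p * h" using *[of h "(1, 0)"] by (simp add: mult.commute)
    qed
    show "(\<lambda>h. ddir (0, h) f p) = (*) (ddir (0, 1) f p)"
    proof
      fix h show "ddir (0, h) f p = ddir (0, 1) f p * h" using *[of h "(0, 1)"] by (simp add: mult.commute)
    qed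
  qed
  have "((\<lambda>x. (x, y)) has_derivative (\<lambda>h. (h, 0))) (at x)"
    by (auto intro!: derivative_eq_intros)
  from has_derivative_compose[OF this D]
  show "((\<lambda>x. f (x, y)) has_real_derivative ddir (1, 0) f (x, y)) (at x)"
    unfolding has_field_derivative_def lin .
  have "((\<lambda>y. (x, y)) has_derivative (\<lambda>h. (0, h))) (at y)"
    by (auto intro!: derivative_eq_intros)
  from has_derivative_compose[OF this D]
  show "((\<lambda>y. f (x, y)) has_real_derivative ddir (0, 1) f (x, y)) (at y)"
    unfolding has_field_derivative_def lin .
qed

text \<open>The divergence theorem on a closed surface. By linearity in \<open>v\<close> it suffices
  to treat the two coordinate directions, where the fundamental theorem leaves boundary values that
  cancel by periodicity.\<close>

lemma torus_integral_ddir: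
  fixes h :: "real \<times> real \<Rightarrow> real"
  assumes h: "smooth_map_on h UNIV" and per: "torus_periodic h"
  shows "torus_integral (ddir v h) = 0"
proof -
  have c: "continuous_on UNIV (ddir w h)" for w
    by (intro smooth_map_on_continuous smooth_ddir h open_UNIV)
  have x: "integral {0..2*pi} (\<lambda>x. ddir (1, 0) h (x, y)) = 0" for y
  proof (rule integral_unique)
    have "((\<lambda>x. ddir (1, 0) h (x, y)) has_integral h (2 * pi, y) - h (0, y)) {0..2*pi}"
      using line_derivative(1)[OF h]
      by (intro fundamental_theorem_of_calculus)
        (auto intro: has_field_derivative_at_within
          simp: has_real_derivative_iff_has_vector_derivative[symmetric])
    moreover have "h (0 + 2 * pi, y) = h (0, y)" using per unfolding torus_periodic_def by blast
    ultimately show "((\<lambda>x. ddir (1, 0) h (x, y)) has_integral 0) {0..2*pi}" by simp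
  qed
  have y: "integral {0..2*pi} (\<lambda>y. ddir (0, 1) h (x, y)) = 0" for x
  proof (rule integral_unique)
    have "((\<lambda>y. ddir (0, 1) h (x, y)) has_integral h (x, 2 * pi) - h (x, 0)) {0..2*pi}"
      using line_derivative(2)[OF h]
      by (intro fundamental_theorem_of_calculus)
        (auto intro: has_field_derivative_at_within
          simp: has_real_derivative_iff_has_vector_derivative[symmetric])
    moreover have "h (x, 0 + 2 * pi) = h (x, 0)" using per unfolding torus_periodic_def by blast
    ultimately show "((\<lambda>y. ddir (0, 1) h (x, y)) has_integral 0) {0..2*pi}" by simp
  qed
  have "torus_integral (ddir (1, 0) h) = 0"
    unfolding torus_integral_iterated(2)[OF c] x by simp
  moreover have "torus_integral (ddir (0, 1) h) = 0"
    unfolding torus_integral_iterated(1)[OF c] y by simp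
  moreover have "ddir v h = (\<lambda>p. fst v * ddir (1, 0) h p + snd v * ddir (0, 1) h p)"
  proof
    fix p
    have L: "linear (\<lambda>v. ddir v h p)" by (rule linear_ddir[OF smooth_map_on_UNIV_differentiable[OF h]])
    show "ddir v h p = fst v * ddir (1, 0) h p + snd v * ddir (0, 1) h p"
      using linear_add[OF L, of "fst v *\<^sub>R (1, 0)" "snd v *\<^sub>R (0, 1)"]
        linear_cmul[OF L, of "fst v" "(1, 0)"] linear_cmul[OF L, of "snd v" "(0, 1)"] by simp
  qed
  ultimately show ?thesis
    by (simp add: torus_integral_add torus_integral_cmult smooth_mult smooth_const smooth_ddir h)
qed

lemma torus_periodicD:
  assumes "torus_periodic f"
  shows "f (\<gamma> + 2 * pi, \<theta>) = f (\<gamma>, \<theta>)" "f (\<gamma>, \<theta> + 2 * pi) = f (\<gamma>, \<theta>)"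
  using assms unfolding torus_periodic_def by auto

lemma torus_periodic_comp2:
  "torus_periodic f \<Longrightarrow> torus_periodic g \<Longrightarrow> torus_periodic (\<lambda>p. h (f p) (g p))"
  unfolding torus_periodic_def by simp

named_theorems periodic_intros

lemmas torus_periodic_binary [periodic_intros] =
  torus_periodic_comp2[where h = "\<lambda>x y. x + y"] torus_periodic_comp2[where h = "\<lambda>x y. x - y"]
  torus_periodic_comp2[where h = "\<lambda>x y. x \<bullet> y"] torus_periodic_comp2[where h = "\<lambda>x y. x *\<^sub>R y"]
  torus_periodic_comp2[where h = "\<lambda>x y. x * y"]

declare torus_periodic_ddir [periodic_intros] torus_periodic_laplacian [periodic_intros]

lemma torus_periodic_const [periodic_intros]: "torus_periodic (\<lambda>p. c)"
  unfolding torus_periodic_def by simp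

lemma green:
  fixes V W :: "real \<times> real \<Rightarrow> 'b::euclidean_space"
  assumes V: "smooth_map_on V UNIV" "torus_periodic V" and W: "smooth_map_on W UNIV" "torus_periodic W"
  shows "torus_integral (\<lambda>p. laplacian V p \<bullet> W p) = torus_integral (\<lambda>p. V p \<bullet> laplacian W p)"
proof -
  \<comment> \<open>The flux of Green's identity in direction \<open>e\<close>; in its derivative
    the products of first derivatives cancel.\<close>
  define h where "h e q = ddir e V q \<bullet> W q - V q \<bullet> ddir e W q" for e q
  have h: "smooth_map_on (h e) UNIV" "torus_periodic (h e)" for e
    unfolding h_def
    by (intro smooth_intros periodic_intros V W open_UNIV)+
  have dh: "ddir e (h e) p = ddir e (ddir e V) p \<bullet> W p - V p \<bullet> ddir e (ddir e W) p" for e p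
    using V(1) W(1) unfolding h_def
    by (subst ddir_diff; (subst ddir_inner)?; (subst ddir_inner)?;
        (intro smooth_map_on_UNIV_differentiable smooth_intros open_UNIV)?; simp)
  have "(\<lambda>p. laplacian V p \<bullet> W p - V p \<bullet> laplacian W p) = (\<lambda>p. ddir (2, 0) (h (2, 0)) p + ddir (0, 2) (h (0, 2)) p)"
    by (simp add: laplacian_def torus_frame_def dh inner_add_left inner_add_right algebra_simps)
  moreover have "torus_integral (\<lambda>p. ddir (2, 0) (h (2, 0)) p + ddir (0, 2) (h (0, 2)) p) = 0"
    by (simp add: torus_integral_add torus_integral_ddir smooth_ddir h)
  ultimately have "torus_integral (\<lambda>p. laplacian V p \<bullet> W p - V p \<bullet> laplacian W p) = 0" by simp
  then show ?thesis by (simp add: torus_integral_diff smooth_inner smooth_laplacian V W)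
qed

text \<open>Integrals see only the box; this transfers a vanishing result from the box to the whole
  plane.\<close>

lemma torus_periodic_reduce:
  assumes "torus_periodic f"
  shows "\<exists>q\<in>torus_box. f p = f q"
proof -
  obtain \<gamma> \<theta> where p: "p = (\<gamma>, \<theta>)" by fastforce
  have shift1: "f (x + of_int n * (2 * pi), y) = f (x, y)" for x y n
  proof (induction n rule: int_induct[where k = 0])
    case (step1 i)
    then show ?case using torus_periodicD(1)[OF assms, of "x + of_int i * (2 * pi)" y]
      by (simp add: algebra_simps)
  next
    case (step2 i)
    then show ?case using torus_periodicD(1)[OF assms, of "x + of_int (i - 1) * (2 * pi)" y]
      by (simp add: algebra_simps)
  qed simp
  have shift2: "f (x, y + of_int n * (2 * pi)) = f (x, y)" for x y n
  proof (induction n rule: int_induct[where k = 0])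
    case (step1 i)
    then show ?case using torus_periodicD(2)[OF assms, of x "y + of_int i * (2 * pi)"]
      by (simp add: algebra_simps)
  next
    case (step2 i)
    then show ?case using torus_periodicD(2)[OF assms, of x "y + of_int (i - 1) * (2 * pi)"]
      by (simp add: algebra_simps)
  qed simp
  have red: "\<exists>n. 0 \<le> x + of_int n * (2 * pi) \<and> x + of_int n * (2 * pi) \<le> 2 * pi" for x :: real
  proof (rule exI[of _ "- \<lfloor>x / (2 * pi)\<rfloor>"])
    have "of_int \<lfloor>x / (2 * pi)\<rfloor> * (2 * pi) \<le> x / (2 * pi) * (2 * pi)"
      by (rule mult_right_mono) auto
    moreover have "x / (2 * pi) * (2 * pi) \<le> (of_int \<lfloor>x / (2 * pi)\<rfloor> + 1) * (2 * pi)"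
      by (rule mult_right_mono) auto
    ultimately show "0 \<le> x + of_int (- \<lfloor>x / (2 * pi)\<rfloor>) * (2 * pi) \<and>
        x + of_int (- \<lfloor>x / (2 * pi)\<rfloor>) * (2 * pi) \<le> 2 * pi"
      by (simp add: algebra_simps)
  qed
  obtain m n where mn: "0 \<le> \<gamma> + of_int m * (2 * pi)" "\<gamma> + of_int m * (2 * pi) \<le> 2 * pi"
    "0 \<le> \<theta> + of_int n * (2 * pi)" "\<theta> + of_int n * (2 * pi) \<le> 2 * pi"
    using red[of \<gamma>] red[of \<theta>] by blast
  show ?thesis
    by (rule bexI[of _ "(\<gamma> + of_int m * (2 * pi), \<theta> + of_int n * (2 * pi))"])
      (use mn in \<open>simp_all add: p shift1 shift2 cbox_Pair_eq\<close>)
qed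

text \<open>This nondegeneracy settles both uniqueness questions: two candidates with equal pairings
  are compared by testing with their difference.\<close>

lemma L2_inner_eq_0_iff:
  assumes "smooth_map_on V UNIV" "torus_periodic V" "L2_inner V V = 0"
  shows "V = (\<lambda>p. 0)"
proof
  fix p
  have c: "continuous_on torus_box (\<lambda>p. V p \<bullet> V p / 4)"
    by (intro continuous_on_subset[OF smooth_map_on_continuous[of _ UNIV]] smooth_divide_const
        smooth_inner assms open_UNIV subset_UNIV)
  have "box (0::real, 0::real) (2 * pi, 2 * pi) \<noteq> {}" by (auto simp: box_ne_empty Basis_prod_def)
  then have "V q \<bullet> V q / 4 = 0" if "q \<in> torus_box" for q
    using integral_cbox_eq_0_iff[OF c] assms(3) that unfolding L2_inner_def torus_integral_def by auto
  moreover obtain q where "q \<in> torus_box" "V p = V q" using torus_periodic_reduce[OF assms(2)] by blast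
  ultimately show "V p = 0" by (metis inner_eq_zero_iff divide_eq_0_iff zero_neq_numeral)
qed

lemma L2_inner_diff_left:
  assumes "smooth_map_on U UNIV" "smooth_map_on V UNIV" "smooth_map_on W UNIV"
  shows "L2_inner (\<lambda>p. U p - V p) W = L2_inner U W - L2_inner V W"
  unfolding L2_inner_def
  by (simp add: inner_diff_left torus_integral_diff smooth_inner assms)

section \<open>Sections and variations along maps to spheres\<close>

lemma sphere_sectionsD:
  assumes "V \<in> sphere_sections \<phi>"
  shows "smooth_map_on V UNIV" "torus_periodic V" "V p \<bullet> \<phi> p = 0"
  using assms unfolding sphere_sections_def by blast+

lemma sphere_sections_diff:
  assumes "U \<in> sphere_sections \<phi>" "V \<in> sphere_sections \<phi>"
  shows "(\<lambda>p. U p - V p) \<in> sphere_sections \<phi>"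
  unfolding sphere_sections_def
  using sphere_sectionsD[OF assms(1)] sphere_sectionsD[OF assms(2)]
  by (auto intro: smooth_diff torus_periodic_comp2 simp: inner_diff_left)

lemma torus_map_sphereD:
  assumes "torus_map (sphere 0 r) \<phi>"
  shows "smooth_map_on \<phi> UNIV" "torus_periodic \<phi>" "norm (\<phi> p) = r"
proof -
  show "smooth_map_on \<phi> UNIV" "torus_periodic \<phi>" using assms unfolding torus_map_def by auto
  have "\<phi> p \<in> sphere 0 r" using assms unfolding torus_map_def by blast
  then show "norm (\<phi> p) = r" by simp
qed

section \<open>Variations obtained by normalising tangential displacements\<close>

definition sphere_push :: "real \<Rightarrow> 'b::euclidean_space \<Rightarrow> 'b \<Rightarrow> 'b" where
  "sphere_push r y u = (1 + u \<bullet> u / r\<^sup>2) powr (- 1 / 2) *\<^sub>R (y + u)"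

text \<open>Since \<open>u\<close> is orthogonal to \<open>y\<close>, the squared norm of
  \<open>y + u\<close> is \<open>r\<^sup>2 + u \<bullet> u\<close>, which the scalar factor rescales
  to \<open>r\<^sup>2\<close>. The base of the power is positive for every \<open>u\<close>, so no
  smallness is required.\<close>

lemma norm_sphere_push:
  assumes "r > 0" "norm y = r" "u \<bullet> y = 0"
  shows "norm (sphere_push r y u) = r"
proof -
  have pos: "1 + u \<bullet> u / r\<^sup>2 > 0" using assms(1) by (simp add: add_pos_nonneg)
  have "(norm (sphere_push r y u))\<^sup>2
      = ((1 + u \<bullet> u / r\<^sup>2) powr (- 1 / 2))\<^sup>2 * ((y + u) \<bullet> (y + u))"
    unfolding sphere_push_def power2_norm_eq_inner by (simp add: power2_eq_square)
  also have "((1 + u \<bullet> u / r\<^sup>2) powr (- 1 / 2))\<^sup>2 = 1 / (1 + u \<bullet> u / r\<^sup>2)"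
    using pos by (simp add: power2_eq_square powr_add[symmetric] powr_minus inverse_eq_divide)
  also have "(y + u) \<bullet> (y + u) = y \<bullet> y + u \<bullet> u"
    using assms(3) by (simp add: inner_add_left inner_add_right inner_commute[of y u])
  also have "\<dots> = r\<^sup>2 * (1 + u \<bullet> u / r\<^sup>2)"
    using assms(1,2) by (simp add: power2_norm_eq_inner[symmetric] distrib_left)
  finally have "(norm (sphere_push r y u))\<^sup>2 = r\<^sup>2" using pos by simp
  then show ?thesis using assms(1) power2_eq_iff_nonneg[of "norm (sphere_push r y u)" r] by simp
qed

text \<open>The normalising factor depends on \<open>t\<close> only through \<open>t * t\<close>, so
  it has derivative 0 at the origin and the velocity is that of the straight line.\<close>

lemma sphere_push_derivative:
  assumes "r > 0"
  shows "((\<lambda>t. sphere_push r y (t *\<^sub>R v)) has_vector_derivative v) (at 0)"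
proof -
  have "((\<lambda>t. (1 + t * t * (v \<bullet> v) / r\<^sup>2) powr (- 1 / 2)) has_real_derivative 0) (at 0)"
    using assms by (auto intro!: derivative_eq_intros)
  moreover have "((\<lambda>t. y + t *\<^sub>R v) has_vector_derivative v) (at 0)"
    by (auto intro!: derivative_eq_intros)
  ultimately have "((\<lambda>t. (1 + t * t * (v \<bullet> v) / r\<^sup>2) powr (- 1 / 2) *\<^sub>R (y + t *\<^sub>R v))
      has_vector_derivative (1 + 0 * 0 * (v \<bullet> v) / r\<^sup>2) powr (- 1 / 2) *\<^sub>R v + 0 *\<^sub>R (y + 0 *\<^sub>R v)) (at 0)"
    by (rule has_vector_derivative_scaleR)
  then show ?thesis by (simp add: sphere_push_def mult.assoc)
qed

lemma smooth_precompose: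
  "open S \<Longrightarrow> smooth_map_on f UNIV \<Longrightarrow> smooth_map_on h S \<Longrightarrow> smooth_map_on (\<lambda>x. f (h x)) S"
  by (rule smooth_compose[of S UNIV h f]) auto

lemma smooth_sphere_push:
  assumes "open S" "r > 0" "smooth_map_on f S" "smooth_map_on u S"
  shows "smooth_map_on (\<lambda>x. sphere_push r (f x) (u x)) S"
  unfolding sphere_push_def
  by (intro smooth_scaleR smooth_powr smooth_add smooth_divide_const smooth_inner smooth_const assms)
    (use assms in \<open>simp add: add_pos_nonneg\<close>)

text \<open>Every pair of sections occurs as a pair of variation fields. Without this the condition
  quantified over all variations could not determine the Jacobi operator.\<close>

lemma sphere_push_variation2:
  assumes r: "r > 0" and \<phi>: "torus_map (sphere 0 r) \<phi>"
    and V: "V \<in> sphere_sections \<phi>" and W: "W \<in> sphere_sections \<phi>"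
  defines "F \<equiv> \<lambda>t s p. sphere_push r (\<phi> p) (t *\<^sub>R V p + s *\<^sub>R W p)"
  shows "variation2 (sphere 0 r) \<phi> F"
    and "variation_field (\<lambda>t. F t 0) = V" and "variation_field (\<lambda>s. F 0 s) = W"
proof -
  note Vd = sphere_sectionsD[OF V] and Wd = sphere_sectionsD[OF W]
  note \<phi>d = torus_map_sphereD[OF \<phi>]
  have F0: "F 0 0 = \<phi>" by (simp add: F_def sphere_push_def)
  have Fm: "torus_map (sphere 0 r) (F t s)" for t s
    unfolding torus_map_def
  proof (intro conjI)
    show "smooth_map_on (F t s) UNIV" unfolding F_def
      by (intro smooth_sphere_push smooth_add smooth_scaleR smooth_const Vd Wd \<phi>d r open_UNIV)
    show "torus_periodic (F t s)"
      using Vd(2) Wd(2) \<phi>d(2) unfolding torus_periodic_def F_def by simp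
    show "range (F t s) \<subseteq> sphere 0 r"
      using norm_sphere_push[OF r \<phi>d(3)] Vd(3) Wd(3) by (auto simp: F_def inner_add_left)
  qed
  have sm: "smooth_map_on (\<lambda>z. F (fst (fst z)) (snd (fst z)) (snd z)) UNIV"
    unfolding F_def
    by (intro smooth_sphere_push smooth_add smooth_scaleR smooth_precompose[OF _ Vd(1)]
        smooth_precompose[OF _ Wd(1)] smooth_precompose[OF _ \<phi>d(1)] smooth_fst smooth_snd
        smooth_ident r open_UNIV)
  have "(\<lambda>((t, s), p). F t s p) = (\<lambda>z. F (fst (fst z)) (snd (fst z)) (snd z))" by auto
  with sm have "smooth_map_on (\<lambda>((t, s), p). F t s p) (({-1<..<1} \<times> {-1<..<1}) \<times> UNIV)"
    using smooth_map_on_subset[OF sm subset_UNIV] by presburger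
  then show "variation2 (sphere 0 r) \<phi> F"
    unfolding variation2_def using F0 Fm by (intro conjI exI[of _ 1]) auto
  show "variation_field (\<lambda>t. F t 0) = V"
    unfolding variation_field_def F_def
    using vector_derivative_at[OF sphere_push_derivative[OF r]] by (auto simp: fun_eq_iff)
  show "variation_field (\<lambda>s. F 0 s) = W"
    unfolding variation_field_def F_def
    using vector_derivative_at[OF sphere_push_derivative[OF r]] by (auto simp: fun_eq_iff)
qed

section \<open>Variation fields are sections\<close>

lemma variation2_slice:
  assumes "variation2 N \<phi> F"
  shows "variation N \<phi> (\<lambda>t. F t 0)" "variation N \<phi> (\<lambda>s. F 0 s)"
proof -
  from assms obtain \<epsilon> where e: "F 0 0 = \<phi>" "\<epsilon> > 0"
    "smooth_map_on (\<lambda>((t, s), p). F t s p) (({-\<epsilon><..<\<epsilon>} \<times> {-\<epsilon><..<\<epsilon>}) \<times> UNIV)"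
    "\<forall>t\<in>{-\<epsilon><..<\<epsilon>}. \<forall>s\<in>{-\<epsilon><..<\<epsilon>}. torus_map N (F t s)"
    unfolding variation2_def by auto
  let ?S = "({-\<epsilon><..<\<epsilon>} \<times> {-\<epsilon><..<\<epsilon>}) \<times> (UNIV :: (real \<times> real) set)"
  let ?T = "{-\<epsilon><..<\<epsilon>} \<times> (UNIV :: (real \<times> real) set)"
  have o: "open ?S" "open ?T" by (intro open_Times; simp)+
  have "smooth_map_on (\<lambda>z. (\<lambda>((t, s), p). F t s p) ((fst z, 0), snd z)) ?T"
    by (rule smooth_compose[OF o(2,1) _ _ e(3)])
      (use e(2) o in \<open>auto intro!: smooth_Pair smooth_fst smooth_snd smooth_ident smooth_const\<close>)
  then show "variation N \<phi> (\<lambda>t. F t 0)"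
    unfolding variation_def using e by (auto intro!: exI[of _ \<epsilon>] simp: case_prod_beta')
  have "smooth_map_on (\<lambda>z. (\<lambda>((t, s), p). F t s p) ((0, fst z), snd z)) ?T"
    by (rule smooth_compose[OF o(2,1) _ _ e(3)])
      (use e(2) o in \<open>auto intro!: smooth_Pair smooth_fst smooth_snd smooth_ident smooth_const\<close>)
  then show "variation N \<phi> (\<lambda>s. F 0 s)"
    unfolding variation_def using e by (auto intro!: exI[of _ \<epsilon>] simp: case_prod_beta')
qed

lemma variation_field_has_derivative:
  assumes F: "variation N \<phi> F"
  shows "((\<lambda>t. F t p) has_vector_derivative variation_field F p) (at 0)"
    and "smooth_map_on (variation_field F) UNIV"
proof -
  from F obtain \<epsilon> where e: "\<epsilon> > 0"
    and sm: "smooth_map_on (\<lambda>(t, p). F t p) ({-\<epsilon><..<\<epsilon>} \<times> UNIV)"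
    unfolding variation_def by auto
  let ?S = "{-\<epsilon><..<\<epsilon>} \<times> (UNIV :: (real \<times> real) set)"
  let ?G = "\<lambda>(t, p). F t p"
  have o: "open ?S" by (intro open_Times) auto
  have der: "((\<lambda>t. F t p) has_vector_derivative ddir (1, 0) ?G (0, p)) (at 0)" for p
  proof -
    have D: "(?G has_derivative (\<lambda>v. ddir v ?G (0, p))) (at (0, p))"
      by (rule smooth_map_on_has_derivative[OF sm o]) (use e in auto)
    have "((\<lambda>t::real. (t, p)) has_derivative (\<lambda>h. (h, 0))) (at 0)"
      by (auto intro!: derivative_eq_intros)
    from has_derivative_compose[OF this D]
    have "((\<lambda>t. F t p) has_derivative (\<lambda>h. ddir (h, 0) ?G (0, p))) (at 0)" by simp
    moreover have "ddir (h, 0) ?G (0, p) = h *\<^sub>R ddir (1, 0) ?G (0, p)" for h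
      using linear_cmul[OF bounded_linear.linear[OF has_derivative_bounded_linear[OF D]], of h "(1, 0)"]
      by simp
    then have "(\<lambda>h. ddir (h, 0) ?G (0, p)) = (\<lambda>h. h *\<^sub>R ddir (1, 0) ?G (0, p))" by (rule ext)
    ultimately show ?thesis unfolding has_vector_derivative_def by metis
  qed
  then have eq: "variation_field F = (\<lambda>p. ddir (1, 0) ?G (0, p))"
    unfolding variation_field_def using vector_derivative_at by blast
  show "((\<lambda>t. F t p) has_vector_derivative variation_field F p) (at 0)"
    unfolding eq by (rule der)
  show "smooth_map_on (variation_field F) UNIV"
    unfolding eq
    by (rule smooth_compose[OF _ o _ _ smooth_ddir[OF o sm]])
      (use e in \<open>auto intro!: smooth_Pair smooth_ident smooth_const\<close>)
qed

text \<open>Tangency comes from differentiating the constant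
  \<open>F t p \<bullet> F t p = r\<^sup>2\<close> at 0, and periodicity from the uniqueness of
  derivatives of equal curves.\<close>

lemma variation_field_in_sections:
  assumes F: "variation (sphere 0 r) \<phi> F"
  shows "variation_field F \<in> sphere_sections \<phi>"
proof -
  from F obtain \<epsilon> where e: "\<epsilon> > 0" "F 0 = \<phi>"
    and m: "\<And>t. t \<in> {-\<epsilon><..<\<epsilon>} \<Longrightarrow> torus_map (sphere 0 r) (F t)"
    unfolding variation_def by auto
  note D = variation_field_has_derivative[OF F]
  have per: "variation_field F p = variation_field F q"
    if "\<And>t. t \<in> {-\<epsilon><..<\<epsilon>} \<Longrightarrow> F t p = F t q" for p q
  proof -
    have "((\<lambda>t. F t q) has_vector_derivative variation_field F p) (at 0)"
      by (rule has_vector_derivative_transform_within_open[OF D(1)[of p], of "{-\<epsilon><..<\<epsilon>}"])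
        (use e that in auto)
    then show ?thesis using vector_derivative_at D(1)[of q] by metis
  qed
  have "torus_periodic (variation_field F)"
    unfolding torus_periodic_def
    using m torus_periodicD unfolding torus_map_def by (intro allI conjI per) blast+
  moreover have "variation_field F p \<bullet> \<phi> p = 0" for p
  proof -
    let ?v = "variation_field F p"
    have "((\<lambda>t. F t p \<bullet> F t p) has_derivative (\<lambda>h. F 0 p \<bullet> (h *\<^sub>R ?v) + (h *\<^sub>R ?v) \<bullet> F 0 p)) (at 0)"
      using D(1)[of p] unfolding has_vector_derivative_def by (intro has_derivative_inner)
    moreover have "((\<lambda>t. F t p \<bullet> F t p) has_derivative (\<lambda>h. 0)) (at 0)"
    proof (rule has_derivative_transform_within_open[OF has_derivative_const[of "r\<^sup>2"], of "{-\<epsilon><..<\<epsilon>}"])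
      fix t assume "t \<in> {-\<epsilon><..<\<epsilon>}"
      from torus_map_sphereD(3)[OF m[OF this]] have "norm (F t p) = r" .
      then show "r\<^sup>2 = F t p \<bullet> F t p" by (simp add: power2_norm_eq_inner[symmetric])
    qed (use e in auto)
    ultimately have "(\<lambda>h. F 0 p \<bullet> (h *\<^sub>R ?v) + (h *\<^sub>R ?v) \<bullet> F 0 p) = (\<lambda>h. 0)"
      by (rule has_derivative_unique)
    from fun_cong[OF this, of 1] e(2) show ?thesis by (simp add: inner_commute)
  qed
  ultimately show ?thesis using D(2) unfolding sphere_sections_def by blast
qed

section \<open>The second variation of the bienergy\<close>

lemma sphere_tangent_proj_sum:
  "finite I \<Longrightarrow> (\<Sum>i\<in>I. sphere_tangent_proj y (v i)) = sphere_tangent_proj y (\<Sum>i\<in>I. v i)"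
  by (induction I rule: finite_induct)
    (simp_all add: sphere_tangent_proj_def inner_add_left add_divide_distrib scaleR_add_left)

text \<open>The tangential projection at a fixed point is linear, so it commutes with the trace over
  the frame.\<close>

lemma tension_eq: "tension \<phi> p = sphere_tangent_proj (\<phi> p) (laplacian \<phi> p)"
  unfolding tension_def second_fundamental_form_def pullback_nabla_def laplacian_def
  by (simp add: sphere_tangent_proj_sum finite_torus_frame ddir_def)

lemma bienergy_eq:
  assumes "torus_map (sphere 0 1) \<phi>"
  shows "bienergy \<phi> = torus_integral
    (\<lambda>p. (laplacian \<phi> p \<bullet> laplacian \<phi> p - (laplacian \<phi> p \<bullet> \<phi> p) * (laplacian \<phi> p \<bullet> \<phi> p)) / 2)"
proof -
  have "(norm (tension \<phi> p))\<^sup>2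
      = laplacian \<phi> p \<bullet> laplacian \<phi> p - (laplacian \<phi> p \<bullet> \<phi> p) * (laplacian \<phi> p \<bullet> \<phi> p)" for p
  proof -
    have "\<phi> p \<bullet> \<phi> p = 1"
      using torus_map_sphereD(3)[OF assms, of p] by (simp add: norm_eq_1)
    then show ?thesis
      by (simp add: tension_eq sphere_tangent_proj_def power2_norm_eq_inner inner_diff_left
          inner_diff_right inner_commute[of "\<phi> p" "laplacian \<phi> p"])
  qed
  then show ?thesis
    unfolding bienergy_def using torus_integral_cmult[of "1 / 2"] by simp
qed

text \<open>Leibniz' rule along a line in an arbitrary parameter space, so that one statement serves
  the derivative in \<open>s\<close> and then the derivative in \<open>t\<close>.\<close>

lemma torus_integral_has_derivative:
  fixes H :: "'e::euclidean_space \<times> (real \<times> real) \<Rightarrow> real"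
  assumes S: "open S" and H: "smooth_map_on H S" and e: "\<epsilon> > 0"
    and sub: "\<And>\<tau> p. \<tau> \<in> {-\<epsilon><..<\<epsilon>} \<Longrightarrow> (z + \<tau> *\<^sub>R w, p) \<in> S"
  shows "((\<lambda>\<tau>. torus_integral (\<lambda>p. H (z + \<tau> *\<^sub>R w, p))) has_real_derivative
    torus_integral (\<lambda>p. ddir (w, 0) H (z, p))) (at 0)"
proof -
  let ?U = "{-\<epsilon><..<\<epsilon>}"
  let ?fx = "\<lambda>\<tau> p. ddir (w, 0) H (z + \<tau> *\<^sub>R w, p)"
  have d: "((\<lambda>\<tau>. H (z + \<tau> *\<^sub>R w, p)) has_real_derivative ?fx \<tau> p) (at \<tau>)" if "\<tau> \<in> ?U" for \<tau> p
  proof -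
    have D: "(H has_derivative (\<lambda>v. ddir v H (z + \<tau> *\<^sub>R w, p))) (at (z + \<tau> *\<^sub>R w, p))"
      by (rule smooth_map_on_has_derivative[OF H S sub[OF that]])
    have "((\<lambda>\<tau>. (z + \<tau> *\<^sub>R w, p)) has_derivative (\<lambda>h. (h *\<^sub>R w, 0))) (at \<tau>)"
      by (auto intro!: derivative_eq_intros)
    from has_derivative_compose[OF this D]
    have "((\<lambda>\<tau>. H (z + \<tau> *\<^sub>R w, p)) has_derivative (\<lambda>h. ddir (h *\<^sub>R w, 0) H (z + \<tau> *\<^sub>R w, p))) (at \<tau>)" .
    moreover have "(\<lambda>h. ddir (h *\<^sub>R w, 0) H (z + \<tau> *\<^sub>R w, p)) = (*) (?fx \<tau> p)"
    proof
      fix h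
      show "ddir (h *\<^sub>R w, 0) H (z + \<tau> *\<^sub>R w, p) = ?fx \<tau> p * h"
        using linear_cmul[OF bounded_linear.linear[OF has_derivative_bounded_linear[OF D]], of h "(w, 0)"]
        by (simp add: mult.commute)
    qed
    ultimately show ?thesis unfolding has_field_derivative_def by metis
  qed
  have cont: "continuous_on (?U \<times> torus_box) (\<lambda>x. g (z + fst x *\<^sub>R w, snd x))"
    if "smooth_map_on g S" for g :: "_ \<Rightarrow> real"
    by (rule continuous_on_compose2[OF smooth_map_on_continuous[OF that]])
      (auto intro!: continuous_intros sub)
  have c1: "continuous_on torus_box (\<lambda>p. H (z + \<tau> *\<^sub>R w, p))" if "\<tau> \<in> ?U" for \<tau>
    by (rule continuous_on_compose2[OF smooth_map_on_continuous[OF H]])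
      (use that in \<open>auto intro!: continuous_intros sub\<close>)
  have "((\<lambda>\<tau>. integral torus_box (\<lambda>p. H (z + \<tau> *\<^sub>R w, p) / 4)) has_real_derivative
      integral torus_box (\<lambda>p. ?fx 0 p / 4)) (at 0 within ?U)"
  proof (rule leibniz_rule_field_derivative[of ?U])
    fix \<tau> p assume "\<tau> \<in> ?U"
    show "((\<lambda>\<tau>. H (z + \<tau> *\<^sub>R w, p) / 4) has_real_derivative ?fx \<tau> p / 4) (at \<tau> within ?U)"
      by (rule has_field_derivative_at_within[OF DERIV_cdivide[OF d[OF \<open>\<tau> \<in> ?U\<close>]]])
  next
    fix \<tau> assume "\<tau> \<in> ?U"
    from c1[OF this] show "(\<lambda>p. H (z + \<tau> *\<^sub>R w, p) / 4) integrable_on torus_box"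
      by (intro integrable_continuous continuous_on_divide continuous_on_const) auto
  next
    show "continuous_on (?U \<times> torus_box) (\<lambda>(\<tau>, p). ?fx \<tau> p / 4)"
      using cont[OF smooth_ddir[OF S H, of "(w, 0)"]]
      by (simp add: case_prod_beta' continuous_on_divide)
  qed (use e in auto)
  moreover have "at 0 within ?U = at (0::real)" using e by (intro at_within_open) auto
  ultimately show ?thesis by (simp add: torus_integral_def)
qed

text \<open>The Laplacian in the torus variables alone, for a map of parameters and torus points
  together. In this form its exchange with parameter derivatives is an instance of the symmetry of
  mixed derivatives.\<close>

definition partial_laplacian ::
  "('e::euclidean_space \<times> (real \<times> real) \<Rightarrow> 'b::euclidean_space) \<Rightarrow> 'e \<times> (real \<times> real) \<Rightarrow> 'b" where
  "partial_laplacian G = (\<lambda>z. \<Sum>e\<in>torus_frame. ddir (0, e) (ddir (0, e) G) z)"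

lemma smooth_partial_laplacian:
  "open S \<Longrightarrow> smooth_map_on G S \<Longrightarrow> smooth_map_on (partial_laplacian G) S"
  unfolding partial_laplacian_def by (intro smooth_sum smooth_ddir)

lemma ddir_slice:
  assumes "G differentiable (at (c, p))"
  shows "ddir e (\<lambda>p. G (c, p)) p = ddir (0, e) G (c, p)"
  using ddir_affine_compose[of "\<lambda>p. (0, p)" G "(c, 0)" p e] assms
  by (simp add: bounded_linear_Pair[OF bounded_linear_zero bounded_linear_ident])

lemma laplacian_slice:
  assumes S: "open S" and G: "smooth_map_on G S" and c: "\<And>p. (c, p) \<in> S"
  shows "laplacian (\<lambda>p. G (c, p)) p = partial_laplacian G (c, p)"
proof -
  have sl: "ddir e (\<lambda>p. g (c, p)) = (\<lambda>p. ddir (0, e) g (c, p))" if "smooth_map_on g S"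
    for e and g :: "_ \<Rightarrow> 'b"
    by (rule ext) (rule ddir_slice[OF smooth_map_on_differentiable[OF that S c]])
  show ?thesis
    unfolding laplacian_def partial_laplacian_def sl[OF G] sl[OF smooth_ddir[OF S G]] ..
qed

lemma ddir_sum:
  assumes "finite I" "\<And>i. i \<in> I \<Longrightarrow> f i differentiable (at x)"
  shows "ddir v (\<lambda>x. \<Sum>i\<in>I. f i x) x = (\<Sum>i\<in>I. ddir v (f i) x)"
  by (rule ddirI[OF has_derivative_sum[OF ddir_has_derivative]]) (use assms in auto)

lemma ddir_partial_laplacian:
  assumes S: "open S" and G: "smooth_map_on G S" and z: "z \<in> S"
  shows "ddir v (partial_laplacian G) z = partial_laplacian (ddir v G) z"
proof -
  have "ddir v (partial_laplacian G) z = (\<Sum>e\<in>torus_frame. ddir v (ddir (0, e) (ddir (0, e) G)) z)"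
    unfolding partial_laplacian_def
    by (rule ddir_sum[OF finite_torus_frame])
      (intro smooth_map_on_differentiable[OF _ S z] smooth_ddir S G)
  also have "\<dots> = (\<Sum>e\<in>torus_frame. ddir (0, e) (ddir (0, e) (ddir v G)) z)"
  proof (rule sum.cong[OF refl])
    fix e
    have "ddir v (ddir (0, e) (ddir (0, e) G)) z = ddir (0, e) (ddir v (ddir (0, e) G)) z"
      by (rule ddir_commute[OF S smooth_ddir[OF S G] z])
    also have "\<dots> = ddir (0, e) (ddir (0, e) (ddir v G)) z"
      by (rule ddir_cong[OF S z ddir_commute[OF S G]])
    finally show "ddir v (ddir (0, e) (ddir (0, e) G)) z = ddir (0, e) (ddir (0, e) (ddir v G)) z" .
  qed
  finally show ?thesis by (simp add: partial_laplacian_def)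
qed

text \<open>Used with a period of the torus as \<open>c\<close>: derivatives in the parameters of a
  variation remain periodic in the torus variables.\<close>

lemma ddir_shift_invariant:
  assumes S: "open S" and G: "smooth_map_on G S" and sh: "\<And>z. z \<in> S \<Longrightarrow> z + c \<in> S"
    and inv: "\<And>z. z \<in> S \<Longrightarrow> G (z + c) = G z" and z: "z \<in> S"
  shows "ddir v G (z + c) = ddir v G z"
proof -
  have "ddir v (\<lambda>z. G (c + z)) z = ddir v G (c + z)"
    using ddir_affine_compose[OF bounded_linear_ident, of G c z v]
      smooth_map_on_differentiable[OF G S sh[OF z]] by (simp add: add.commute)
  moreover have "ddir v (\<lambda>z. G (c + z)) z = ddir v G z"
    by (rule ddir_cong[OF S z]) (simp add: inv add.commute)
  ultimately show ?thesis by (simp add: add.commute)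
qed

lemma ddir_energy_density:
  fixes A G :: "'a::euclidean_space \<Rightarrow> 'b::euclidean_space"
  assumes S: "open S" and A: "smooth_map_on A S" and G: "smooth_map_on G S" and z: "z \<in> S"
  shows "ddir v (\<lambda>z. (A z \<bullet> A z - (A z \<bullet> G z) * (A z \<bullet> G z)) / 2) z
    = A z \<bullet> ddir v A z - (A z \<bullet> G z) * (ddir v A z \<bullet> G z + A z \<bullet> ddir v G z)"
proof (rule ddirI[THEN trans])
  have "(A has_derivative (\<lambda>v. ddir v A z)) (at z)" "(G has_derivative (\<lambda>v. ddir v G z)) (at z)"
    by (intro smooth_map_on_has_derivative[OF _ S z] A G)+
  then show "((\<lambda>z. (A z \<bullet> A z - (A z \<bullet> G z) * (A z \<bullet> G z)) / 2) has_derivative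
      (\<lambda>v. (A z \<bullet> ddir v A z + ddir v A z \<bullet> A z - ((A z \<bullet> G z) * (A z \<bullet> ddir v G z + ddir v A z \<bullet> G z)
         + (A z \<bullet> ddir v G z + ddir v A z \<bullet> G z) * (A z \<bullet> G z))) / 2)) (at z)"
    by (auto intro!: derivative_eq_intros)
qed (simp add: inner_commute[of "ddir v A z" "A z"] field_simps)

lemma ddir_energy_density2:
  fixes A G A' G' :: "'a::euclidean_space \<Rightarrow> 'b::euclidean_space"
  assumes S: "open S" and A: "smooth_map_on A S" and G: "smooth_map_on G S"
    and A': "smooth_map_on A' S" and G': "smooth_map_on G' S" and z: "z \<in> S"
  shows "ddir v (\<lambda>z. A z \<bullet> A' z - (A z \<bullet> G z) * (A' z \<bullet> G z + A z \<bullet> G' z)) z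
    = ddir v A z \<bullet> A' z + A z \<bullet> ddir v A' z
      - (ddir v A z \<bullet> G z + A z \<bullet> ddir v G z) * (A' z \<bullet> G z + A z \<bullet> G' z)
      - (A z \<bullet> G z) * (ddir v A' z \<bullet> G z + A' z \<bullet> ddir v G z + ddir v A z \<bullet> G' z + A z \<bullet> ddir v G' z)"
proof (rule ddirI[THEN trans])
  have "(A has_derivative (\<lambda>v. ddir v A z)) (at z)" "(G has_derivative (\<lambda>v. ddir v G z)) (at z)"
    "(A' has_derivative (\<lambda>v. ddir v A' z)) (at z)" "(G' has_derivative (\<lambda>v. ddir v G' z)) (at z)"
    by (intro smooth_map_on_has_derivative[OF _ S z] A G A' G')+
  then show "((\<lambda>z. A z \<bullet> A' z - (A z \<bullet> G z) * (A' z \<bullet> G z + A z \<bullet> G' z)) has_derivative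
      (\<lambda>v. (A z \<bullet> ddir v A' z + ddir v A z \<bullet> A' z)
        - ((A z \<bullet> G z) * ((A' z \<bullet> ddir v G z + ddir v A' z \<bullet> G z) + (A z \<bullet> ddir v G' z + ddir v A z \<bullet> G' z))
          + (A z \<bullet> ddir v G z + ddir v A z \<bullet> G z) * (A' z \<bullet> G z + A z \<bullet> G' z)))) (at z)"
    by (auto intro!: derivative_eq_intros)
qed (simp add: algebra_simps)

text \<open>\<open>Q\<close> is the mixed derivative of \<open>F\<close> in \<open>t\<close> and
  \<open>s\<close> at the origin, taken in the ambient space. It is in general not tangent to the
  sphere, and \<open>V\<close> and \<open>W\<close> do not determine it, so it is exposed here and
  removed only for a particular \<phi>.\<close>

lemma second_variation:
  assumes F: "variation2 (sphere 0 1) \<phi> F"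
  defines "V \<equiv> variation_field (\<lambda>t. F t 0)" and "W \<equiv> variation_field (\<lambda>s. F 0 s)"
  obtains Q where "smooth_map_on Q UNIV" "torus_periodic Q"
    "deriv (\<lambda>t. deriv (\<lambda>s. bienergy (F t s)) 0) 0 = torus_integral (\<lambda>p.
        laplacian V p \<bullet> laplacian W p + laplacian \<phi> p \<bullet> laplacian Q p
        - (laplacian V p \<bullet> \<phi> p + laplacian \<phi> p \<bullet> V p) * (laplacian W p \<bullet> \<phi> p + laplacian \<phi> p \<bullet> W p)
        - (laplacian \<phi> p \<bullet> \<phi> p) * (laplacian Q p \<bullet> \<phi> p + laplacian W p \<bullet> V p + laplacian V p \<bullet> W p
            + laplacian \<phi> p \<bullet> Q p))"
proof -
  from F obtain \<epsilon> where F0: "F 0 0 = \<phi>" and e: "\<epsilon> > 0"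
    and sm: "smooth_map_on (\<lambda>((t, s), p). F t s p) (({-\<epsilon><..<\<epsilon>} \<times> {-\<epsilon><..<\<epsilon>}) \<times> UNIV)"
    and m: "\<And>t s. t \<in> {-\<epsilon><..<\<epsilon>} \<Longrightarrow> s \<in> {-\<epsilon><..<\<epsilon>} \<Longrightarrow> torus_map (sphere 0 1) (F t s)"
    unfolding variation2_def by auto
  define S where "S = ({-\<epsilon><..<\<epsilon>} \<times> {-\<epsilon><..<\<epsilon>}) \<times> (UNIV :: (real \<times> real) set)"
  define G where "G = (\<lambda>((t, s), p). F t s p)"
  have G_apply: "G ((t, s), p) = F t s p" for t s p by (simp add: G_def)
  have S: "open S" unfolding S_def by (intro open_Times) auto
  have G: "smooth_map_on G S" using sm unfolding S_def G_def .
  have inS: "((t, s), p) \<in> S" if "t \<in> {-\<epsilon><..<\<epsilon>}" "s \<in> {-\<epsilon><..<\<epsilon>}" for t s p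
    using that by (simp add: S_def)
  have 0: "0 \<in> {-\<epsilon><..<\<epsilon>}" using e by simp
  let ?T = "((1, 0), 0) :: (real \<times> real) \<times> (real \<times> real)"
  let ?S = "((0, 1), 0) :: (real \<times> real) \<times> (real \<times> real)"
  define A where "A = partial_laplacian G"
  have A: "smooth_map_on A S" unfolding A_def by (rule smooth_partial_laplacian[OF S G])
  define H where "H = (\<lambda>z. (A z \<bullet> A z - (A z \<bullet> G z) * (A z \<bullet> G z)) / 2)"
  have H: "smooth_map_on H S"
    unfolding H_def by (intro smooth_intros S A G)
  define H1 where "H1 = ddir ?S H"
  have H1: "smooth_map_on H1 S" unfolding H1_def by (rule smooth_ddir[OF S H])
  have lap: "laplacian (F t s) p = A ((t, s), p)"
    if "t \<in> {-\<epsilon><..<\<epsilon>}" "s \<in> {-\<epsilon><..<\<epsilon>}" for t s p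
    using laplacian_slice[OF S G inS[OF that], of p] by (simp add: A_def G_apply)
  have E: "bienergy (F t s) = torus_integral (\<lambda>p. H ((t, s), p))"
    if "t \<in> {-\<epsilon><..<\<epsilon>}" "s \<in> {-\<epsilon><..<\<epsilon>}" for t s
    using bienergy_eq[OF m[OF that]] by (simp add: lap[OF that] H_def G_apply)
  \<comment> \<open>Required for all small \<open>t\<close> and not only at 0, because the outer
    derivative is taken of this function of \<open>t\<close>.\<close>
  have E1: "deriv (\<lambda>s. bienergy (F t s)) 0 = torus_integral (\<lambda>p. H1 ((t, 0), p))"
    if t: "t \<in> {-\<epsilon><..<\<epsilon>}" for t
  proof (rule DERIV_imp_deriv)
    have "((\<lambda>s. torus_integral (\<lambda>p. H ((t, 0) + s *\<^sub>R (0, 1), p))) has_real_derivative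
        torus_integral (\<lambda>p. ddir ((0, 1), 0) H ((t, 0), p))) (at 0)"
      by (rule torus_integral_has_derivative[OF S H e]) (use t inS in simp)
    then have "((\<lambda>s. torus_integral (\<lambda>p. H ((t, s), p))) has_real_derivative
        torus_integral (\<lambda>p. H1 ((t, 0), p))) (at 0)" by (simp add: H1_def)
    then show "((\<lambda>s. bienergy (F t s)) has_real_derivative torus_integral (\<lambda>p. H1 ((t, 0), p))) (at 0)"
      by (rule has_field_derivative_transform_within_open[where S = "{-\<epsilon><..<\<epsilon>}"])
        (use t 0 E in auto)
  qed
  have E2: "deriv (\<lambda>t. deriv (\<lambda>s. bienergy (F t s)) 0) 0 = torus_integral (\<lambda>p. ddir ?T H1 ((0, 0), p))"
  proof (rule DERIV_imp_deriv)
    have "((\<lambda>t. torus_integral (\<lambda>p. H1 ((0, 0) + t *\<^sub>R (1, 0), p))) has_real_derivative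
        torus_integral (\<lambda>p. ddir ((1, 0), 0) H1 ((0, 0), p))) (at 0)"
      by (rule torus_integral_has_derivative[OF S H1 e]) (use 0 inS in simp)
    then have "((\<lambda>t. torus_integral (\<lambda>p. H1 ((t, 0), p))) has_real_derivative
        torus_integral (\<lambda>p. ddir ?T H1 ((0, 0), p))) (at 0)" by simp
    then show "((\<lambda>t. deriv (\<lambda>s. bienergy (F t s)) 0) has_real_derivative
        torus_integral (\<lambda>p. ddir ?T H1 ((0, 0), p))) (at 0)"
      by (rule has_field_derivative_transform_within_open[where S = "{-\<epsilon><..<\<epsilon>}"])
        (use 0 E1 in auto)
  qed
  \<comment> \<open>the second-order part of the variation\<close>
  define Q where "Q = (\<lambda>p. ddir ?T (ddir ?S G) ((0, 0), p))"
  have z0: "((0, 0), p) \<in> S" for p by (rule inS[OF 0 0])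
  have sl: "smooth_map_on (\<lambda>p. g ((0, 0), p)) UNIV" if "smooth_map_on g S"
    for g :: "_ \<Rightarrow> 'a"
    by (rule smooth_compose[OF open_UNIV S _ _ that]) (use z0 in \<open>auto intro!: smooth_intros\<close>)
  have Q: "smooth_map_on Q UNIV"
    unfolding Q_def by (intro sl smooth_ddir S G)
  have shS: "z + (0, c) \<in> S" if "z \<in> S" for z and c
    using that by (auto simp: S_def)
  have "Q (p + c) = Q p" if c: "c = (2 * pi, 0) \<or> c = (0, 2 * pi)" for p c
  proof -
    have inv: "G (z + (0, c)) = G z" if "z \<in> S" for z
    proof -
      obtain t s \<gamma> \<theta> where z: "z = ((t, s), (\<gamma>, \<theta>))" by (metis surj_pair)
      then have "torus_periodic (F t s)"
        using that m[of t s] unfolding torus_map_def S_def by auto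
      from torus_periodicD[OF this] c show ?thesis by (auto simp: z G_apply)
    qed
    note i1 = ddir_shift_invariant[OF S G shS inv]
    from ddir_shift_invariant[OF S smooth_ddir[OF S G] shS i1 z0] show ?thesis
      by (simp add: Q_def)
  qed
  from this[of "(2 * pi, 0)"] this[of "(0, 2 * pi)"] have Qper: "torus_periodic Q"
    unfolding torus_periodic_def by auto
  have V: "ddir ?T G ((0, 0), p) = V p" for p
  proof -
    have "(G has_derivative (\<lambda>v. ddir v G ((0, 0), p))) (at ((0, 0), p))"
      by (rule smooth_map_on_has_derivative[OF G S z0])
    note D = this
    have "((\<lambda>t. ((t, 0), p)) has_derivative (\<lambda>h. ((h, 0), 0))) (at 0)"
      by (auto intro!: derivative_eq_intros)
    from has_derivative_compose[OF this D]
    have "((\<lambda>t. F t 0 p) has_derivative (\<lambda>h. ddir ((h, 0), 0) G ((0, 0), p))) (at 0)"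
      by (simp add: G_apply)
    moreover have "ddir ((h, 0), 0) G ((0, 0), p) = h *\<^sub>R ddir ?T G ((0, 0), p)" for h
      using linear_cmul[OF bounded_linear.linear[OF has_derivative_bounded_linear[OF D]], of h ?T] by simp
    then have "(\<lambda>h. ddir ((h, 0), 0) G ((0, 0), p)) = (\<lambda>h. h *\<^sub>R ddir ?T G ((0, 0), p))" by (rule ext)
    ultimately have "((\<lambda>t. F t 0 p) has_vector_derivative ddir ?T G ((0, 0), p)) (at 0)"
      unfolding has_vector_derivative_def by metis
    then show ?thesis unfolding V_def variation_field_def using vector_derivative_at by metis
  qed
  have W: "ddir ?S G ((0, 0), p) = W p" for p
  proof -
    have "(G has_derivative (\<lambda>v. ddir v G ((0, 0), p))) (at ((0, 0), p))"
      by (rule smooth_map_on_has_derivative[OF G S z0])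
    note D = this
    have "((\<lambda>s. ((0, s), p)) has_derivative (\<lambda>h. ((0, h), 0))) (at 0)"
      by (auto intro!: derivative_eq_intros)
    from has_derivative_compose[OF this D]
    have "((\<lambda>s. F 0 s p) has_derivative (\<lambda>h. ddir ((0, h), 0) G ((0, 0), p))) (at 0)"
      by (simp add: G_apply)
    moreover have "ddir ((0, h), 0) G ((0, 0), p) = h *\<^sub>R ddir ?S G ((0, 0), p)" for h
      using linear_cmul[OF bounded_linear.linear[OF has_derivative_bounded_linear[OF D]], of h ?S] by simp
    then have "(\<lambda>h. ddir ((0, h), 0) G ((0, 0), p)) = (\<lambda>h. h *\<^sub>R ddir ?S G ((0, 0), p))" by (rule ext)
    ultimately have "((\<lambda>s. F 0 s p) has_vector_derivative ddir ?S G ((0, 0), p)) (at 0)"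
      unfolding has_vector_derivative_def by metis
    then show ?thesis unfolding W_def variation_field_def using vector_derivative_at by metis
  qed
  have lapS: "partial_laplacian g ((0, 0), p) = laplacian (\<lambda>p. g ((0, 0), p)) p" if "smooth_map_on g S"
    for g :: "_ \<Rightarrow> 'a" and p
    by (rule laplacian_slice[OF S that z0, symmetric])
  have At: "ddir ?T A ((0, 0), p) = laplacian V p" for p
    unfolding A_def using ddir_partial_laplacian[OF S G z0] lapS[OF smooth_ddir[OF S G]] by (simp add: V)
  have As: "ddir ?S A ((0, 0), p) = laplacian W p" for p
    unfolding A_def using ddir_partial_laplacian[OF S G z0] lapS[OF smooth_ddir[OF S G]] by (simp add: W)
  have "ddir ?T (ddir ?S A) ((0, 0), p) = ddir ?T (partial_laplacian (ddir ?S G)) ((0, 0), p)" for p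
    unfolding A_def by (rule ddir_cong[OF S z0 ddir_partial_laplacian[OF S G]])
  also have "\<dots> p = laplacian Q p" for p
    using ddir_partial_laplacian[OF S smooth_ddir[OF S G] z0] lapS[OF smooth_ddir[OF S smooth_ddir[OF S G]]]
    unfolding Q_def by simp
  finally have Ats: "ddir ?T (ddir ?S A) ((0, 0), p) = laplacian Q p" for p .
  have A0: "A ((0, 0), p) = laplacian \<phi> p" for p using lap[OF 0 0] F0 by simp
  have G0: "G ((0, 0), p) = \<phi> p" for p by (simp add: G_apply F0)
  have "ddir ?T H1 ((0, 0), p)
    = ddir ?T (\<lambda>z. A z \<bullet> ddir ?S A z - (A z \<bullet> G z) * (ddir ?S A z \<bullet> G z + A z \<bullet> ddir ?S G z)) ((0, 0), p)"
    for p
    unfolding H1_def H_def by (rule ddir_cong[OF S z0 ddir_energy_density[OF S A G]])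
  also have "\<dots> p =
        laplacian V p \<bullet> laplacian W p + laplacian \<phi> p \<bullet> laplacian Q p
        - (laplacian V p \<bullet> \<phi> p + laplacian \<phi> p \<bullet> V p) * (laplacian W p \<bullet> \<phi> p + laplacian \<phi> p \<bullet> W p)
        - (laplacian \<phi> p \<bullet> \<phi> p) * (laplacian Q p \<bullet> \<phi> p + laplacian W p \<bullet> V p + laplacian V p \<bullet> W p
            + laplacian \<phi> p \<bullet> Q p)" for p
    by (subst ddir_energy_density2[OF S A G smooth_ddir[OF S A] smooth_ddir[OF S G] z0])
      (simp add: At As Ats A0 G0 V W Q_def)
  finally show thesis using that[OF Q Qper] E2 by simp
qed

section \<open>The Jacobi operator at the Clifford torus\<close>

text \<open>A family containing the Clifford torus and closed under directional derivatives, so that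
  differentiation becomes an operation on coefficient vectors.\<close>

definition trig_map :: "'b::euclidean_space \<Rightarrow> 'b \<Rightarrow> 'b \<Rightarrow> 'b \<Rightarrow> 'b \<Rightarrow> real \<times> real \<Rightarrow> 'b" where
  "trig_map a b c d k = (\<lambda>p. cos (fst p) *\<^sub>R a + sin (fst p) *\<^sub>R b + cos (snd p) *\<^sub>R c + sin (snd p) *\<^sub>R d + k)"

lemma smooth_trig_map: "smooth_map_on (trig_map a b c d k) UNIV"
  unfolding trig_map_def by (intro smooth_intros open_UNIV)

lemma torus_periodic_trig_map: "torus_periodic (trig_map a b c d k)"
  unfolding torus_periodic_def trig_map_def by simp

lemma ddir_trig_map:
  "ddir v (trig_map a b c d k)
    = trig_map (fst v *\<^sub>R b) (- fst v *\<^sub>R a) (snd v *\<^sub>R d) (- snd v *\<^sub>R c) 0"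
proof
  fix p
  have "(trig_map a b c d k has_derivative
      (\<lambda>v. trig_map (fst v *\<^sub>R b) (- fst v *\<^sub>R a) (snd v *\<^sub>R d) (- snd v *\<^sub>R c) 0 p)) (at p)"
    unfolding trig_map_def
    by (auto intro!: derivative_eq_intros simp: algebra_simps)
  then show "ddir v (trig_map a b c d k) p
    = trig_map (fst v *\<^sub>R b) (- fst v *\<^sub>R a) (snd v *\<^sub>R d) (- snd v *\<^sub>R c) 0 p" by (rule ddirI)
qed

lemma laplacian_trig_map:
  "laplacian (trig_map a b c d k) p = trig_map (- 4 *\<^sub>R a) (- 4 *\<^sub>R b) (- 4 *\<^sub>R c) (- 4 *\<^sub>R d) 0 p"
  by (simp add: laplacian_def torus_frame_def ddir_trig_map) (simp add: trig_map_def)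

lemma vector_4:
  "(vector [w, x, y, z] :: 'a::zero^4)$1 = w"
  "(vector [w, x, y, z] :: 'a::zero^4)$2 = x"
  "(vector [w, x, y, z] :: 'a::zero^4)$3 = y"
  "(vector [w, x, y, z] :: 'a::zero^4)$4 = z"
  by (simp_all add: vector_def)

lemma clifford_torus_eq:
  "clifford_torus = trig_map (axis 1 (1/2)) (axis 2 (1/2)) (axis 3 (1/2)) (axis 4 (1/2)) 0"
proof
  fix p
  have ne: "(1::4) \<noteq> 2" "(1::4) \<noteq> 3" "(1::4) \<noteq> 4" "(2::4) \<noteq> 3" "(2::4) \<noteq> 4" "(3::4) \<noteq> 4"
    by simp_all
  show "clifford_torus p = trig_map (axis 1 (1/2)) (axis 2 (1/2)) (axis 3 (1/2)) (axis 4 (1/2)) 0 p"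
    unfolding vec_eq_iff forall_4
    by (simp add: clifford_torus_def trig_map_def case_prod_beta axis_def vector_4 ne ne[symmetric])
qed

lemma Phi_eq: "Phi p = (clifford_torus p, 1 / sqrt 2)"
  by (simp add: Phi_def small_hypersphere_incl_def)

lemma clifford_torus_smooth: "smooth_map_on clifford_torus UNIV" "torus_periodic clifford_torus"
  unfolding clifford_torus_eq by (rule smooth_trig_map torus_periodic_trig_map)+

text \<open>This eigenvalue equation expresses minimality in the small sphere: for a minimal surface
  in a sphere of radius \<rho> the eigenvalue is \<open>- 2 / \<rho>\<^sup>2\<close>, and here
  \<open>\<rho>\<^sup>2 = 1/2\<close>.\<close>

lemma laplacian_clifford_torus: "laplacian clifford_torus = (\<lambda>p. (- 4) *\<^sub>R clifford_torus p)"
  unfolding clifford_torus_eq fun_eq_iff laplacian_trig_map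
  by (simp add: trig_map_def algebra_simps)

lemma inner_real_4: "x \<bullet> y = x$1 * y$1 + x$2 * y$2 + x$3 * y$3 + x$4 * y$4" for x y :: "real^4"
  by (simp add: inner_vec_def sum_4)

lemma clifford_torus_inner: "clifford_torus p \<bullet> clifford_torus p = 1 / 2"
proof -
  have "sin x * sin x + cos x * cos x = 1" for x :: real
    by (metis sin_cos_squared_add3 add.commute)
  from this[of "fst p"] this[of "snd p"] show ?thesis
    by (simp add: inner_real_4 clifford_torus_def case_prod_beta vector_4)
qed

lemma Phi_smooth: "smooth_map_on Phi UNIV" "torus_periodic Phi"
proof -
  have eq: "Phi = (\<lambda>p. (clifford_torus p, 1 / sqrt 2))" by (rule ext) (rule Phi_eq)
  show "smooth_map_on Phi UNIV"
    unfolding eq by (simp add: smooth_Pair smooth_const clifford_torus_smooth)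
  show "torus_periodic Phi"
    using clifford_torus_smooth(2) by (simp add: torus_periodic_def Phi_eq)
qed

lemma Phi_inner: "Phi p \<bullet> Phi p = 1"
  by (simp add: Phi_eq clifford_torus_inner)

lemma torus_map_clifford: "torus_map (sphere 0 (1 / sqrt 2)) clifford_torus"
  unfolding torus_map_def
  by (auto simp: clifford_torus_smooth norm_eq_sqrt_inner clifford_torus_inner real_sqrt_divide)

lemma torus_map_Phi: "torus_map (sphere 0 1) Phi"
  unfolding torus_map_def by (auto simp: Phi_smooth norm_eq_sqrt_inner Phi_inner)

lemma laplacian_Pair:
  assumes "smooth_map_on f UNIV" "smooth_map_on g UNIV"
  shows "laplacian (\<lambda>p. (f p, g p)) = (\<lambda>p. (laplacian f p, laplacian g p))"
proof -
  have "ddir v (\<lambda>p. (f p, g p)) = (\<lambda>p. (ddir v f p, ddir v g p))"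
    if "smooth_map_on f UNIV" "smooth_map_on g UNIV" for v and f :: "_ \<Rightarrow> 'a" and g :: "_ \<Rightarrow> 'b"
    by (rule ext, rule ddirI, rule has_derivative_Pair)
      (intro ddir_has_derivative smooth_map_on_UNIV_differentiable that)+
  note * = this
  show ?thesis
    unfolding laplacian_def fun_eq_iff *[OF assms]
      *[OF smooth_ddir[OF open_UNIV assms(1)] smooth_ddir[OF open_UNIV assms(2)]]
    by (simp add: torus_frame_def)
qed

lemma laplacian_const: "laplacian (\<lambda>p. c) = (\<lambda>p. 0)"
  by (simp add: laplacian_def fun_eq_iff ddir_def)

lemma laplacian_Phi: "laplacian Phi = (\<lambda>p. ((- 4) *\<^sub>R clifford_torus p, 0))"
proof -
  have eq: "Phi = (\<lambda>p. (clifford_torus p, 1 / sqrt 2))" by (rule ext) (rule Phi_eq)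
  show ?thesis
    unfolding eq by (simp add: laplacian_Pair laplacian_const laplacian_clifford_torus clifford_torus_smooth
        smooth_const del: scaleR_minus_left)
qed

lemma laplacian_scaleR_const:
  assumes "smooth_map_on f UNIV"
  shows "laplacian (\<lambda>p. c *\<^sub>R f p) = (\<lambda>p. c *\<^sub>R laplacian f p)"
proof -
  have "ddir v (\<lambda>p. c *\<^sub>R f p) = (\<lambda>p. c *\<^sub>R ddir v f p)" if "smooth_map_on f UNIV"
    for v and f :: "_ \<Rightarrow> 'a"
    by (rule ext)
      (rule ddir_linear_compose[OF bounded_linear_scaleR_right smooth_map_on_UNIV_differentiable[OF that]])
  note * = this
  show ?thesis
    unfolding laplacian_def fun_eq_iff *[OF assms] *[OF smooth_ddir[OF open_UNIV assms]]
    by (simp add: torus_frame_def scaleR_add_right)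
qed

lemma laplacian2_Phi: "laplacian (laplacian Phi) = (\<lambda>p. (16 *\<^sub>R clifford_torus p, 0))"
  unfolding laplacian_Phi
  by (simp add: laplacian_Pair laplacian_const laplacian_scaleR_const laplacian_clifford_torus
      clifford_torus_smooth smooth_const smooth_scaleR del: scaleR_minus_left)

text \<open>The value is minus the squared norm of the differential of \<Phi>; each of the two frame
  vectors is mapped to a unit vector.\<close>

lemma laplacian_Phi_inner: "laplacian Phi p \<bullet> Phi p = - 2"
  by (simp add: laplacian_Phi Phi_eq clifford_torus_inner)

section \<open>The Hessian at \<Phi> and an explicit Jacobi operator\<close>

definition normal_variation :: "(real \<times> real \<Rightarrow> (real^4) \<times> real) \<Rightarrow> real \<times> real \<Rightarrow> real" where
  "normal_variation V p = laplacian V p \<bullet> Phi p + laplacian Phi p \<bullet> V p"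

text \<open>The second variation integrand at \<Phi> without the terms in \<open>Q\<close>. Here
  \<open>normal_variation\<close> is the first-order change of the product of
  \<open>laplacian F\<close> with \<open>F\<close>, and the factor 2 is
  \<open>- (laplacian Phi p \<bullet> Phi p)\<close>.\<close>

definition hessian_density ::
  "(real \<times> real \<Rightarrow> (real^4) \<times> real) \<Rightarrow> (real \<times> real \<Rightarrow> (real^4) \<times> real) \<Rightarrow> real \<times> real \<Rightarrow> real" where
  "hessian_density V W p = laplacian V p \<bullet> laplacian W p - normal_variation V p * normal_variation W p
    + 2 * (laplacian W p \<bullet> V p + laplacian V p \<bullet> W p)"

text \<open>What remains next to \<open>W\<close> in the integral of
  \<open>hessian_density V W\<close> once Green's identity has moved all derivatives off
  \<open>W\<close>. The two symmetric first-power terms with factor 2 merge into the single term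
  with factor 4.\<close>

definition ambient_jacobi ::
  "(real \<times> real \<Rightarrow> (real^4) \<times> real) \<Rightarrow> real \<times> real \<Rightarrow> (real^4) \<times> real" where
  "ambient_jacobi V p = laplacian (laplacian V) p + 4 *\<^sub>R laplacian V p
    - laplacian (\<lambda>q. normal_variation V q *\<^sub>R Phi q) p - normal_variation V p *\<^sub>R laplacian Phi p"

definition Phi_jacobi ::
  "(real \<times> real \<Rightarrow> (real^4) \<times> real) \<Rightarrow> real \<times> real \<Rightarrow> (real^4) \<times> real" where
  "Phi_jacobi V p = ambient_jacobi V p - (ambient_jacobi V p \<bullet> Phi p) *\<^sub>R Phi p"

lemma normal_variation_smooth:
  assumes "V \<in> sphere_sections Phi"
  shows "smooth_map_on (normal_variation V) UNIV" "torus_periodic (normal_variation V)"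
proof -
  have eq: "normal_variation V = (\<lambda>p. laplacian V p \<bullet> Phi p + laplacian Phi p \<bullet> V p)"
    by (rule ext) (rule normal_variation_def)
  show "smooth_map_on (normal_variation V) UNIV" "torus_periodic (normal_variation V)"
    unfolding eq
    by (intro smooth_intros periodic_intros sphere_sectionsD[OF assms] Phi_smooth open_UNIV)+
qed

lemma ambient_jacobi_smooth:
  assumes V: "V \<in> sphere_sections Phi"
  shows "smooth_map_on (ambient_jacobi V) UNIV" "torus_periodic (ambient_jacobi V)"
proof -
  have eq: "ambient_jacobi V = (\<lambda>p. laplacian (laplacian V) p + 4 *\<^sub>R laplacian V p
    - laplacian (\<lambda>q. normal_variation V q *\<^sub>R Phi q) p - normal_variation V p *\<^sub>R laplacian Phi p)"
    by (rule ext) (rule ambient_jacobi_def)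
  show "smooth_map_on (ambient_jacobi V) UNIV" "torus_periodic (ambient_jacobi V)"
    unfolding eq
    by (intro smooth_intros periodic_intros normal_variation_smooth[OF V] sphere_sectionsD[OF V]
        Phi_smooth open_UNIV)+
qed

lemma Phi_jacobi_section:
  assumes V: "V \<in> sphere_sections Phi"
  shows "Phi_jacobi V \<in> sphere_sections Phi"
proof -
  have eq: "Phi_jacobi V = (\<lambda>p. ambient_jacobi V p - (ambient_jacobi V p \<bullet> Phi p) *\<^sub>R Phi p)"
    by (rule ext) (rule Phi_jacobi_def)
  have "smooth_map_on (Phi_jacobi V) UNIV" "torus_periodic (Phi_jacobi V)"
    unfolding eq
    by (intro smooth_intros periodic_intros ambient_jacobi_smooth[OF V] Phi_smooth open_UNIV)+
  then show ?thesis
    unfolding sphere_sections_def by (simp add: Phi_jacobi_def inner_diff_left Phi_inner)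
qed

text \<open>Pairing with \<open>W\<close>, which is orthogonal to \<Phi>, makes the normal
  correction in \<open>Phi_jacobi\<close> invisible; the remainder is Green's identity, applied to
  \<open>laplacian V\<close>, to \<open>normal_variation V\<close> times \<Phi>, and to
  \<open>V\<close> itself.\<close>

lemma L2_Phi_jacobi:
  assumes V: "V \<in> sphere_sections Phi" and W: "W \<in> sphere_sections Phi"
  shows "L2_inner (Phi_jacobi V) W = torus_integral (hessian_density V W)"
proof -
  note Vd = sphere_sectionsD[OF V] and Wd = sphere_sectionsD[OF W]
  note sV = normal_variation_smooth[OF V]
  note sm = smooth_intros Vd(1) Wd(1) Phi_smooth(1) sV(1) open_UNIV
  note per = periodic_intros Vd(2) Wd(2) Phi_smooth(2) sV(2)
  let ?g = "normal_variation V"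
  let ?gP = "\<lambda>q. ?g q *\<^sub>R Phi q"
  have gP: "smooth_map_on ?gP UNIV" "torus_periodic ?gP" by (intro sm per)+
  have lV: "smooth_map_on (laplacian V) UNIV" "torus_periodic (laplacian V)"
    by (intro sm, intro per sm)
  have g1: "torus_integral (\<lambda>p. laplacian (laplacian V) p \<bullet> W p) = torus_integral (\<lambda>p. laplacian V p \<bullet> laplacian W p)"
    by (rule green[OF lV Wd(1,2)])
  have g2: "torus_integral (\<lambda>p. laplacian ?gP p \<bullet> W p) = torus_integral (\<lambda>p. ?gP p \<bullet> laplacian W p)"
    by (rule green[OF gP Wd(1,2)])
  have g3: "torus_integral (\<lambda>p. laplacian W p \<bullet> V p) = torus_integral (\<lambda>p. laplacian V p \<bullet> W p)"
    using green[OF Wd(1,2) Vd(1,2)] by (simp add: inner_commute)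
  have "L2_inner (Phi_jacobi V) W = torus_integral (\<lambda>p. laplacian (laplacian V) p \<bullet> W p
      + 4 * (laplacian V p \<bullet> W p) - laplacian ?gP p \<bullet> W p - ?g p * (laplacian Phi p \<bullet> W p))"
    unfolding L2_inner_def
    by (simp add: Phi_jacobi_def ambient_jacobi_def inner_diff_left inner_add_left
        inner_commute[of "Phi _" "W _"] Wd(3))
  also have "\<dots> = torus_integral (\<lambda>p. laplacian V p \<bullet> laplacian W p)
      + 4 * torus_integral (\<lambda>p. laplacian V p \<bullet> W p) - torus_integral (\<lambda>p. ?gP p \<bullet> laplacian W p)
      - torus_integral (\<lambda>p. ?g p * (laplacian Phi p \<bullet> W p))"
    by (subst torus_integral_diff torus_integral_add, intro sm gP lV, intro sm gP lV)+
      (simp add: g1 g2 torus_integral_cmult)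
  also have "\<dots> = torus_integral (\<lambda>p. laplacian V p \<bullet> laplacian W p - ?g p * normal_variation W p
      + 2 * (laplacian W p \<bullet> V p + laplacian V p \<bullet> W p))"
  proof -
    have "torus_integral (\<lambda>p. laplacian V p \<bullet> laplacian W p - ?g p * normal_variation W p
        + 2 * (laplacian W p \<bullet> V p + laplacian V p \<bullet> W p))
      = torus_integral (\<lambda>p. laplacian V p \<bullet> laplacian W p - ?gP p \<bullet> laplacian W p
        - ?g p * (laplacian Phi p \<bullet> W p)
        + 2 * (laplacian W p \<bullet> V p + laplacian V p \<bullet> W p))"
      by (simp add: normal_variation_def[of W] inner_commute[of "Phi _" "laplacian W _"] distrib_left
          diff_diff_eq)
    also have "\<dots> = torus_integral (\<lambda>p. laplacian V p \<bullet> laplacian W p) - torus_integral (\<lambda>p. ?gP p \<bullet> laplacian W p)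
        - torus_integral (\<lambda>p. ?g p * (laplacian Phi p \<bullet> W p))
        + 2 * (torus_integral (\<lambda>p. laplacian W p \<bullet> V p) + torus_integral (\<lambda>p. laplacian V p \<bullet> W p))"
      by (subst torus_integral_diff torus_integral_add torus_integral_cmult, intro sm gP lV, intro sm gP lV)+
        (subst torus_integral_cmult, subst torus_integral_add, intro sm, intro sm, simp)
    finally show ?thesis by (simp add: g3)
  qed
  finally show ?thesis unfolding hessian_density_def .
qed

lemma second_variation_Phi:
  assumes F: "variation2 (sphere 0 1) Phi F"
  defines "V \<equiv> variation_field (\<lambda>t. F t 0)" and "W \<equiv> variation_field (\<lambda>s. F 0 s)"
  shows "deriv (\<lambda>t. deriv (\<lambda>s. bienergy (F t s)) 0) 0 = torus_integral (hessian_density V W)"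
proof -
  obtain Q where Q: "smooth_map_on Q UNIV" "torus_periodic Q"
    and eq: "deriv (\<lambda>t. deriv (\<lambda>s. bienergy (F t s)) 0) 0 = torus_integral (\<lambda>p.
        laplacian V p \<bullet> laplacian W p + laplacian Phi p \<bullet> laplacian Q p
        - (laplacian V p \<bullet> Phi p + laplacian Phi p \<bullet> V p) * (laplacian W p \<bullet> Phi p + laplacian Phi p \<bullet> W p)
        - (laplacian Phi p \<bullet> Phi p) * (laplacian Q p \<bullet> Phi p + laplacian W p \<bullet> V p + laplacian V p \<bullet> W p
            + laplacian Phi p \<bullet> Q p))"
    using second_variation[OF F] unfolding V_def W_def by blast
  have V: "V \<in> sphere_sections Phi" and W: "W \<in> sphere_sections Phi"
    unfolding V_def W_def by (rule variation_field_in_sections variation2_slice[OF F])+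
  note sm = smooth_intros Q(1) Phi_smooth(1) open_UNIV
  have lP: "smooth_map_on (laplacian Phi) UNIV" "torus_periodic (laplacian Phi)"
    by (intro sm, intro periodic_intros Phi_smooth)
  have hd: "smooth_map_on (hessian_density V W) UNIV"
    unfolding hessian_density_def
    by (intro sm normal_variation_smooth[OF V] normal_variation_smooth[OF W] sphere_sectionsD(1)[OF V]
        sphere_sectionsD(1)[OF W])
  have "torus_integral (\<lambda>p. laplacian Phi p \<bullet> laplacian Q p) = torus_integral (\<lambda>p. laplacian (laplacian Phi) p \<bullet> Q p)"
    using green[OF lP Q] by simp
  moreover have "torus_integral (\<lambda>p. laplacian Q p \<bullet> Phi p) = torus_integral (\<lambda>p. laplacian Phi p \<bullet> Q p)"
    using green[OF Q Phi_smooth] by (simp add: inner_commute)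
  moreover have "torus_integral (\<lambda>p. laplacian (laplacian Phi) p \<bullet> Q p)
      = torus_integral (\<lambda>p. (- 4) * (laplacian Phi p \<bullet> Q p))"
  proof -
    have "laplacian (laplacian Phi) p = (- 4) *\<^sub>R laplacian Phi p" for p
      by (subst laplacian2_Phi) (simp add: laplacian_Phi)
    then show ?thesis by simp
  qed
  \<comment> \<open>this is \<open>(\<Delta>\<^sup>2\<Phi> + 4\<Delta>\<Phi>, Q) = 0\<close> after integration by parts\<close>
  ultimately have zero: "torus_integral (\<lambda>p. laplacian Phi p \<bullet> laplacian Q p)
      + 2 * (torus_integral (\<lambda>p. laplacian Q p \<bullet> Phi p) + torus_integral (\<lambda>p. laplacian Phi p \<bullet> Q p)) = 0"
    using torus_integral_cmult[of "- 4" "\<lambda>p. laplacian Phi p \<bullet> Q p"] by simp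
  have "deriv (\<lambda>t. deriv (\<lambda>s. bienergy (F t s)) 0) 0 = torus_integral (\<lambda>p. hessian_density V W p
      + (laplacian Phi p \<bullet> laplacian Q p + 2 * (laplacian Q p \<bullet> Phi p + laplacian Phi p \<bullet> Q p)))"
    unfolding eq hessian_density_def normal_variation_def laplacian_Phi_inner
    by (rule arg_cong[of _ _ torus_integral], rule ext) (simp add: algebra_simps)
  also have "\<dots> = torus_integral (hessian_density V W)
      + (torus_integral (\<lambda>p. laplacian Phi p \<bullet> laplacian Q p)
      + 2 * (torus_integral (\<lambda>p. laplacian Q p \<bullet> Phi p) + torus_integral (\<lambda>p. laplacian Phi p \<bullet> Q p)))"
    by (subst torus_integral_add, rule hd, intro sm, subst torus_integral_add, intro sm, intro sm,
        subst torus_integral_cmult, subst torus_integral_add, intro sm, intro sm, rule refl)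
  finally show ?thesis using zero by simp
qed

text \<open>\<open>Phi_jacobi V\<close> has the required pairings. Any other candidate has the same
  pairings with all sections, because each section is realised as the second field of a variation
  whose first field is \<open>V\<close>.\<close>

lemma generalised_jacobi_Phi:
  assumes V: "V \<in> sphere_sections Phi"
  shows "generalised_jacobi 1 Phi V = Phi_jacobi V"
  unfolding generalised_jacobi_def
proof (rule the_equality, intro conjI allI impI)
  show J: "Phi_jacobi V \<in> sphere_sections Phi" by (rule Phi_jacobi_section[OF V])
  fix F assume F: "variation2 (sphere 0 1) Phi F \<and> variation_field (\<lambda>t. F t 0) = V"
  have W: "variation_field (\<lambda>s. F 0 s) \<in> sphere_sections Phi"
    by (rule variation_field_in_sections[OF variation2_slice(2)[OF conjunct1[OF F]]])
  show "deriv (\<lambda>t. deriv (\<lambda>s. bienergy (F t s)) 0) 0 = L2_inner (Phi_jacobi V) (variation_field (\<lambda>s. F 0 s))"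
    using second_variation_Phi[OF conjunct1[OF F]] L2_Phi_jacobi[OF V W] F by simp
next
  fix Z assume Z: "Z \<in> sphere_sections Phi \<and>
    (\<forall>F. variation2 (sphere 0 1) Phi F \<and> variation_field (\<lambda>t. F t 0) = V \<longrightarrow>
      deriv (\<lambda>t. deriv (\<lambda>s. bienergy (F t s)) 0) 0 = L2_inner Z (variation_field (\<lambda>s. F 0 s)))"
  have J: "Phi_jacobi V \<in> sphere_sections Phi" by (rule Phi_jacobi_section[OF V])
  have *: "L2_inner Z W = L2_inner (Phi_jacobi V) W" if W: "W \<in> sphere_sections Phi" for W
  proof -
    define F where "F = (\<lambda>t s p. sphere_push 1 (Phi p) (t *\<^sub>R V p + s *\<^sub>R W p))"
    have F: "variation2 (sphere 0 1) Phi F" "variation_field (\<lambda>t. F t 0) = V"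
      "variation_field (\<lambda>s. F 0 s) = W"
      unfolding F_def using sphere_push_variation2[OF zero_less_one torus_map_Phi V W] by auto
    then have "deriv (\<lambda>t. deriv (\<lambda>s. bienergy (F t s)) 0) 0 = L2_inner Z W" using Z by metis
    then show ?thesis using second_variation_Phi[OF F(1)] L2_Phi_jacobi[OF V W] F by simp
  qed
  \<comment> \<open>The difference of the candidates is itself an admissible test section.\<close>
  define D where "D = (\<lambda>p. Z p - Phi_jacobi V p)"
  have D: "D \<in> sphere_sections Phi" unfolding D_def by (rule sphere_sections_diff[OF conjunct1[OF Z] J])
  have "L2_inner D D = 0"
    using *[OF D] L2_inner_diff_left[OF sphere_sectionsD(1)[OF conjunct1[OF Z]]
        sphere_sectionsD(1)[OF J] sphere_sectionsD(1)[OF D]] by (simp add: D_def)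
  from L2_inner_eq_0_iff[OF sphere_sectionsD(1,2)[OF D] this] show "Z = Phi_jacobi V"
    by (simp add: D_def fun_eq_iff)
qed

section \<open>Variations inside the small hypersphere and the projection onto them\<close>

lemma W_phi_eq: "W_phi = {V. \<exists>v\<in>sphere_sections clifford_torus. V = (\<lambda>p. (v p, 0))}"
proof -
  have field: "variation_field (\<lambda>t. small_hypersphere_incl \<circ> F t) = (\<lambda>p. (variation_field F p, 0))"
    if "variation (sphere 0 (1 / sqrt 2)) clifford_torus F" for F
  proof
    fix p
    have "((\<lambda>t. (F t p, 1 / sqrt 2)) has_vector_derivative (variation_field F p, 0)) (at 0)"
      by (intro has_vector_derivative_Pair variation_field_has_derivative(1)[OF that]
          has_vector_derivative_const)
    then show "variation_field (\<lambda>t. small_hypersphere_incl \<circ> F t) p = (variation_field F p, 0)"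
      by (simp add: variation_field_def[of "\<lambda>t. small_hypersphere_incl \<circ> F t"]
          small_hypersphere_incl_def vector_derivative_at)
  qed
  have "\<exists>F. variation (sphere 0 (1 / sqrt 2)) clifford_torus F \<and> variation_field F = v"
    if v: "v \<in> sphere_sections clifford_torus" for v
  proof -
    \<comment> \<open>The field in the \<open>s\<close> direction is arbitrary, since only the slice
      \<open>s = 0\<close> is retained; \<open>v\<close> is used for both.\<close>
    let ?F = "\<lambda>t s p. sphere_push (1 / sqrt 2) (clifford_torus p) (t *\<^sub>R v p + s *\<^sub>R v p)"
    have F: "variation2 (sphere 0 (1 / sqrt 2)) clifford_torus ?F"
      "variation_field (\<lambda>t. ?F t 0) = v"
      using sphere_push_variation2[OF _ torus_map_clifford v v] by auto
    from variation2_slice(1)[OF F(1)] F(2) show ?thesis by blast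
  qed
  note ex = this
  show ?thesis
  proof (intro equalityI subsetI)
    fix V assume "V \<in> W_phi"
    then obtain F where F: "variation (sphere 0 (1 / sqrt 2)) clifford_torus F"
      and V: "V = variation_field (\<lambda>t. small_hypersphere_incl \<circ> F t)"
      unfolding W_phi_def by blast
    show "V \<in> {V. \<exists>v\<in>sphere_sections clifford_torus. V = (\<lambda>p. (v p, 0))}"
      using variation_field_in_sections[OF F] unfolding V field[OF F] by blast
  next
    fix V assume "V \<in> {V. \<exists>v\<in>sphere_sections clifford_torus. V = (\<lambda>p. (v p, 0 :: real))}"
    then obtain v where v: "v \<in> sphere_sections clifford_torus" and V: "V = (\<lambda>p. (v p, 0))"
      by blast
    obtain F where F: "variation (sphere 0 (1 / sqrt 2)) clifford_torus F" "variation_field F = v"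
      using ex[OF v] by blast
    show "V \<in> W_phi"
      unfolding W_phi_def V using F(1) field[OF F(1)] F(2) by auto
  qed
qed

lemma W_phi_sphere_sections:
  assumes "V \<in> W_phi"
  shows "V \<in> sphere_sections Phi"
proof -
  from assms obtain v where v: "v \<in> sphere_sections clifford_torus" and V: "V = (\<lambda>p. (v p, 0))"
    unfolding W_phi_eq by blast
  have "smooth_map_on V UNIV"
    unfolding V by (intro smooth_intros sphere_sectionsD(1)[OF v] open_UNIV)
  moreover have "torus_periodic V"
    using sphere_sectionsD(2)[OF v] by (simp add: V torus_periodic_def)
  ultimately show ?thesis
    using sphere_sectionsD(3)[OF v] by (simp add: V sphere_sections_def Phi_eq)
qed

lemma W_phi_diff:
  assumes "U \<in> W_phi" "V \<in> W_phi"
  shows "(\<lambda>p. U p - V p) \<in> W_phi"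
proof -
  from assms obtain u v where "u \<in> sphere_sections clifford_torus" "U = (\<lambda>p. (u p, 0))"
    "v \<in> sphere_sections clifford_torus" "V = (\<lambda>p. (v p, 0))"
    unfolding W_phi_eq by blast
  then show ?thesis
    unfolding W_phi_eq using sphere_sections_diff[of u clifford_torus v] by auto
qed

text \<open>The projection is self-adjoint and fixes \<open>W\<close>, so it disappears from the
  quadratic form. It exists because it can be carried out pointwise by a smooth formula.\<close>

lemma L2_W_phi_proj:
  assumes Z: "Z \<in> sphere_sections Phi" and W: "W \<in> W_phi"
  shows "L2_inner (W_phi_proj Z) W = L2_inner Z W"
proof -
  \<comment> \<open>The last coordinate is dropped and the component along
    \<open>clifford_torus p\<close> removed; the factor 2 is the reciprocal of the squared length
    1/2 of that vector.\<close>
  define u where "u = (\<lambda>p. fst (Z p) - (2 * (fst (Z p) \<bullet> clifford_torus p)) *\<^sub>R clifford_torus p)"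
  define U where "U = (\<lambda>p. (u p, 0 :: real))"
  note Zd = sphere_sectionsD[OF Z]
  have "smooth_map_on u UNIV"
    unfolding u_def by (intro smooth_intros Zd(1) clifford_torus_smooth open_UNIV)
  moreover have "torus_periodic u"
    using Zd(2) clifford_torus_smooth(2) by (simp add: u_def torus_periodic_def)
  ultimately have "u \<in> sphere_sections clifford_torus"
    unfolding sphere_sections_def by (simp add: u_def inner_diff_left clifford_torus_inner)
  then have U: "U \<in> W_phi" unfolding W_phi_eq U_def by blast
  have orth: "L2_inner (\<lambda>p. Z p - U p) W' = 0" if "W' \<in> W_phi" for W'
  proof -
    from that obtain w where w: "w \<in> sphere_sections clifford_torus" and W': "W' = (\<lambda>p. (w p, 0))"
      unfolding W_phi_eq by blast
    have "(Z p - U p) \<bullet> W' p = 0" for p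
      using sphere_sectionsD(3)[OF w, of p]
      by (simp add: W' U_def u_def inner_prod_def inner_commute[of "clifford_torus p"])
    then show ?thesis by (simp add: L2_inner_def torus_integral_def)
  qed
  have "W_phi_proj Z = U"
    unfolding W_phi_proj_def
  proof (rule the_equality)
    show "U \<in> W_phi \<and> (\<forall>W\<in>W_phi. L2_inner (\<lambda>p. Z p - U p) W = 0)" using U orth by blast
  next
    fix U' assume U': "U' \<in> W_phi \<and> (\<forall>W\<in>W_phi. L2_inner (\<lambda>p. Z p - U' p) W = 0)"
    define D where "D = (\<lambda>p. U' p - U p)"
    have D: "D \<in> W_phi" unfolding D_def using W_phi_diff U' U by blast
    note s = sphere_sectionsD(1)[OF W_phi_sphere_sections]
    have "L2_inner Z D - L2_inner U D = 0" "L2_inner Z D - L2_inner U' D = 0"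
      using orth[OF D] U' D L2_inner_diff_left[OF Zd(1) s[OF U] s[OF D]]
        L2_inner_diff_left[OF Zd(1) s s[OF D], of U'] by auto
    then have "L2_inner D D = 0"
      using L2_inner_diff_left[OF s s[OF U] s[OF D], of U'] U' by (simp add: D_def)
    from L2_inner_eq_0_iff[OF sphere_sectionsD(1,2)[OF W_phi_sphere_sections[OF D]] this]
    show "U' = U" by (simp add: D_def fun_eq_iff)
  qed
  then show ?thesis
    using orth[OF W] L2_inner_diff_left[OF Zd(1) sphere_sectionsD(1)[OF W_phi_sphere_sections[OF U]]
        sphere_sectionsD(1)[OF W_phi_sphere_sections[OF W]]] by simp
qed

lemma hessian_E2_Phi_eq:
  assumes v: "v \<in> sphere_sections clifford_torus"
  shows "hessian_E2_Phi (\<lambda>p. (v p, 0)) (\<lambda>p. (v p, 0)) = torus_integral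
    (\<lambda>p. laplacian v p \<bullet> laplacian v p - (laplacian v p \<bullet> clifford_torus p)\<^sup>2 + 4 * (laplacian v p \<bullet> v p))"
proof -
  let ?V = "\<lambda>p. (v p, 0 :: real)"
  have V: "?V \<in> W_phi" unfolding W_phi_eq using v by blast
  note Vs = W_phi_sphere_sections[OF V]
  have "hessian_E2_Phi ?V ?V = torus_integral (hessian_density ?V ?V)"
    unfolding hessian_E2_Phi_def I2_Phi_pi_def generalised_jacobi_Phi[OF Vs]
      L2_W_phi_proj[OF Phi_jacobi_section[OF Vs] V] by (rule L2_Phi_jacobi[OF Vs Vs])
  \<comment> \<open>\<open>laplacian Phi\<close> is a multiple of the position on the torus, so its
    product with \<open>V\<close> vanishes by tangency and \<open>normal_variation\<close> keeps
    only its first summand.\<close>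
  moreover have "hessian_density ?V ?V p = laplacian v p \<bullet> laplacian v p
      - (laplacian v p \<bullet> clifford_torus p)\<^sup>2 + 4 * (laplacian v p \<bullet> v p)" for p
    using sphere_sectionsD(3)[OF v, of p]
    by (simp add: hessian_density_def normal_variation_def laplacian_Phi Phi_eq
        laplacian_Pair[OF sphere_sectionsD(1)[OF v] smooth_const[OF open_UNIV]] laplacian_const
        power2_eq_square inner_commute[of "clifford_torus p"])
  then have "hessian_density ?V ?V = (\<lambda>p. laplacian v p \<bullet> laplacian v p
      - (laplacian v p \<bullet> clifford_torus p)\<^sup>2 + 4 * (laplacian v p \<bullet> v p))" by blast
  ultimately show ?thesis by metis
qed

section \<open>Positivity\<close>

lemma tendsto_quotient_at_zeros:
  assumes "(f has_real_derivative df) (at e)" "(g has_real_derivative dg) (at e)"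
    "f e = 0" "g e = 0" "dg \<noteq> 0"
  shows "((\<lambda>x. f x / g x) \<longlongrightarrow> df / dg) (at e)"
proof -
  have "((\<lambda>x. ((f x - f e) / (x - e)) / ((g x - g e) / (x - e))) \<longlongrightarrow> df / dg) (at e)"
    using assms by (intro tendsto_divide) (simp_all add: has_field_derivative_iff)
  then show ?thesis
    by (rule Lim_transform_eventually)
      (use assms in \<open>auto simp: eventually_at_filter divide_simps\<close>)
qed

lemma wirtinger_dirichlet:
  fixes h h' :: "real \<Rightarrow> real"
  assumes h: "\<And>x. (h has_real_derivative h' x) (at x)" and c: "continuous_on UNIV h'"
    and z: "h a = 0" "h (a + pi) = 0"
  shows "0 \<le> integral {a..a+pi} (\<lambda>x. (h' x)\<^sup>2 - (h x)\<^sup>2)"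
proof -
  define s where "s x = sin (x - a)" for x
  define co where "co x = cos (x - a)" for x
  \<comment> \<open>\<open>k = h\<^sup>2 cot (x - a)\<close> is chosen so that \<open>h'\<^sup>2 - h\<^sup>2 - k' = (h' - h cot (x - a))\<^sup>2\<close>; it vanishes at
    both ends of the interval, also formally, as \<open>x / 0 = 0\<close>\<close>
  define k where "k = (\<lambda>x. (h x / s x) * h x * co x)"
  define k' where "k' x = 2 * h x * h' x * (co x / s x) - (h x)\<^sup>2 / (s x)\<^sup>2" for x
  have ds: "(s has_real_derivative co x) (at x)" and dc: "(co has_real_derivative - s x) (at x)" for x
    unfolding s_def co_def by (auto intro!: derivative_eq_intros)
  have sc: "(s x)\<^sup>2 + (co x)\<^sup>2 = 1" for x by (simp add: s_def co_def)
  have pos: "s x > 0" if "x \<in> {a<..<a+pi}" for x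
    using that by (auto simp: s_def intro: sin_gt_zero)
  have dk: "(k has_real_derivative k' x) (at x)" if "x \<in> {a<..<a+pi}" for x
  proof -
    have s0: "s x \<noteq> 0" using pos[OF that] by simp
    have "(k has_real_derivative ((h' x * s x - h x * co x) / (s x * s x) * h x + h' x * (h x / s x)) * co x
        + (- s x) * ((h x / s x) * h x)) (at x)"
      unfolding k_def by (intro DERIV_mult DERIV_divide h ds dc s0)
    moreover have "((h' x * s x - h x * co x) / (s x * s x) * h x + h' x * (h x / s x)) * co x
        + (- s x) * ((h x / s x) * h x) = 2 * h x * h' x * (co x / s x) - (h x)\<^sup>2 * ((s x)\<^sup>2 + (co x)\<^sup>2) / (s x)\<^sup>2"
      using s0 by (simp add: field_simps power2_eq_square)
    ultimately show ?thesis by (simp add: k'_def sc)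
  qed
  \<comment> \<open>At an end both \<open>h\<close> and \<open>s\<close> vanish and \<open>s\<close>
    has the nonzero derivative \<open>co x\<close>. Hence \<open>h / s\<close> has a finite limit,
    and the further factor \<open>h\<close> makes \<open>k\<close> tend to 0, the value it takes
    there.\<close>
  have ck: "isCont k x" if "x \<in> {a..a+pi}" for x
  proof (cases "x \<in> {a<..<a+pi}")
    case True
    then show ?thesis using dk DERIV_isCont by blast
  next
    case False
    with that have "x = a \<or> x = a + pi" by auto
    then have x: "h x = 0" "s x = 0" "co x \<noteq> 0" using z by (auto simp: s_def co_def)
    have "((\<lambda>x. (h x / s x) * h x * co x) \<longlongrightarrow> (h' x / co x) * h x * co x) (at x)"
      using DERIV_isCont[OF h[of x]] DERIV_isCont[OF dc[of x]] unfolding isCont_def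
      by (intro tendsto_mult tendsto_quotient_at_zeros[OF h ds] x)
    then show ?thesis unfolding isCont_def k_def by (simp add: x)
  qed
  have kz: "k a = 0" "k (a + pi) = 0" using z by (simp_all add: k_def)
  have "(k' has_integral k (a + pi) - k a) {a..a+pi}"
    using dk ck by (intro fundamental_theorem_of_calculus_interior)
      (auto intro: continuous_at_imp_continuous_on simp: has_real_derivative_iff_has_vector_derivative[symmetric])
  then have I1: "(k' has_integral 0) {a..a+pi}" by (simp add: kz)
  have "continuous_on {a..a+pi} (\<lambda>x. (h' x)\<^sup>2 - (h x)\<^sup>2)"
    using continuous_on_subset[OF c] DERIV_isCont[OF h]
    by (intro continuous_intros) (auto intro: continuous_at_imp_continuous_on)
  then have I2: "((\<lambda>x. (h' x)\<^sup>2 - (h x)\<^sup>2) has_integral integral {a..a+pi} (\<lambda>x. (h' x)\<^sup>2 - (h x)\<^sup>2)) {a..a+pi}"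
    by (intro integrable_integral integrable_continuous_real)
  have "0 \<le> integral {a..a+pi} (\<lambda>x. (h' x)\<^sup>2 - (h x)\<^sup>2) - 0"
  proof (rule has_integral_nonneg[OF has_integral_diff[OF I2 I1]])
    fix x assume x: "x \<in> {a..a+pi}"
    have "(h' x)\<^sup>2 - (h x)\<^sup>2 - k' x = (h' x - h x * (co x / s x))\<^sup>2"
    proof (cases "s x = 0")
      \<comment> \<open>At the two ends every quotient by \<open>s x\<close> is 0 by convention and
        \<open>h x = 0\<close>, so both sides reduce to \<open>(h' x)\<^sup>2\<close>.\<close>
      case True
      have "x = a \<or> x = a + pi" using pos[of x] True x by force
      then show ?thesis using z by (auto simp: k'_def)
    next
      case False
      have "(h' x)\<^sup>2 - (h x)\<^sup>2 * (((s x)\<^sup>2 + (co x)\<^sup>2) - (co x)\<^sup>2) / (s x)\<^sup>2 - k' x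
          = (h' x - h x * (co x / s x))\<^sup>2"
        unfolding k'_def using sc[of x] False by (simp add: field_simps power2_eq_square)
      then show ?thesis using False by simp
    qed
    then show "0 \<le> (h' x)\<^sup>2 - (h x)\<^sup>2 - k' x" by simp
  qed
  then show ?thesis by simp
qed

lemma integral_periodic_shift:
  fixes q :: "real \<Rightarrow> real"
  assumes c: "continuous_on UNIV q" and per: "\<And>x. q (x + T) = q x" and x: "0 \<le> x" "x \<le> T"
  shows "integral {x..x+T} q = integral {0..T} q"
proof -
  have int: "q integrable_on {a..b}" for a b
    using continuous_on_subset[OF c] by (intro integrable_continuous_real) auto
  have "integral {x..x+T} q = integral {x..T} q + integral {T..x+T} q"
    using Henstock_Kurzweil_Integration.integral_combine[where a = x and c = T and b = "x + T", OF _ _ int] x by simp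
  also have "integral {T..x+T} q = integral {0..x} q"
  proof -
    have "q \<circ> (+) T = q" using per by (auto simp: fun_eq_iff add.commute)
    then show ?thesis using integral_shift_Icc_real[of 0 x q T] by (simp add: add.commute)
  qed
  also have "integral {x..T} q + integral {0..x} q = integral {0..T} q"
    using Henstock_Kurzweil_Integration.integral_combine[OF x int] by simp
  finally show ?thesis .
qed

text \<open>The constant \<open>m\<close> is the common value of \<open>u\<close> at two antipodal
  points, not its mean. Subtracting it gives zero boundary values on both half circles, each of
  length pi, where the Dirichlet version applies. For the later use any constant will do.\<close>

lemma wirtinger_periodic:
  fixes u u' :: "real \<Rightarrow> real"
  assumes u: "\<And>x. (u has_real_derivative u' x) (at x)" and c: "continuous_on UNIV u'"
    and per: "\<And>x. u (x + 2 * pi) = u x" "\<And>x. u' (x + 2 * pi) = u' x"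
  obtains m where "0 \<le> integral {0..2*pi} (\<lambda>x. (u' x)\<^sup>2 - (u x - m)\<^sup>2)"
proof -
  have cu: "continuous_on UNIV u" using DERIV_isCont[OF u] by (auto intro: continuous_at_imp_continuous_on)
  \<comment> \<open>A zero of \<open>d\<close> is a pair of antipodal points with equal values; it
    exists because \<open>d\<close> takes opposite values at 0 and \<open>pi\<close>.\<close>
  define d where "d x = u x - u (x + pi)" for x
  have "d pi = - d 0" using per(1)[of 0] by (simp add: d_def)
  then have "(d 0 \<le> 0 \<and> 0 \<le> d pi) \<or> (d pi \<le> 0 \<and> 0 \<le> d 0)" by linarith
  moreover have "isCont d x" for x
    unfolding d_def using DERIV_isCont[OF u] by (intro continuous_intros isCont_o2[of _ "\<lambda>x. x + pi"]) auto
  ultimately obtain a where a: "0 \<le> a" "a \<le> pi" "d a = 0"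
    using IVT[of d 0 0 pi] IVT2[of d pi 0 0] by (metis pi_ge_zero)
  define m where "m = u a"
  have ua: "u a - m = 0" "u (a + pi) - m = 0" "u (a + pi + pi) - m = 0"
    using a(3) per(1)[of a] by (auto simp: m_def d_def algebra_simps)
  let ?q = "\<lambda>x. (u' x)\<^sup>2 - (u x - m)\<^sup>2"
  have du: "((\<lambda>x. u x - m) has_real_derivative u' x) (at x)" for x
    using u by (auto intro!: derivative_eq_intros)
  have cq: "continuous_on UNIV ?q" by (intro continuous_intros c cu)
  have int: "?q integrable_on {a..b}" for a b
    using continuous_on_subset[OF cq] by (intro integrable_continuous_real) auto
  have "0 \<le> integral {a..a+pi} ?q + integral {a+pi..a+pi+pi} ?q"
    using wirtinger_dirichlet[OF du c ua(1,2)] wirtinger_dirichlet[OF du c ua(2,3)] by simp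
  also have "\<dots> = integral {a..a+2*pi} ?q"
  proof -
    have "a + pi + pi = a + 2 * pi" by simp
    moreover have "integral {a..a+pi} ?q + integral {a+pi..a+pi+pi} ?q = integral {a..a+pi+pi} ?q"
      by (rule Henstock_Kurzweil_Integration.integral_combine[OF _ _ int]) auto
    ultimately show ?thesis by (simp only:)
  qed
  also have "\<dots> = integral {0..2*pi} ?q"
    by (rule integral_periodic_shift[OF cq]) (use a per in auto)
  finally show thesis by (rule that)
qed

text \<open>As in Hurwitz's proof of the isoperimetric inequality: the integral of
  \<open>u v'\<close> is the signed area enclosed by the closed curve \<open>(u, v)\<close>, which
  is bounded by the Dirichlet integral of the curve.\<close>

lemma isoperimetric_form_nonneg:
  fixes u u' v v' :: "real \<Rightarrow> real"
  assumes u: "\<And>x. (u has_real_derivative u' x) (at x)" "continuous_on UNIV u'"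
    and v: "\<And>x. (v has_real_derivative v' x) (at x)" "continuous_on UNIV v'"
    and per: "\<And>x. u (x + 2 * pi) = u x" "\<And>x. u' (x + 2 * pi) = u' x" "v (2 * pi) = v 0"
  shows "0 \<le> integral {0..2*pi} (\<lambda>x. (u' x)\<^sup>2 + (v' x)\<^sup>2 + 2 * (u x * v' x))"
proof -
  obtain m where m: "0 \<le> integral {0..2*pi} (\<lambda>x. (u' x)\<^sup>2 - (u x - m)\<^sup>2)"
    using wirtinger_periodic[OF u per(1,2)] by blast
  have cu: "continuous_on UNIV u" using DERIV_isCont[OF u(1)] by (auto intro: continuous_at_imp_continuous_on)
  have int: "g integrable_on {0..2*pi}" if "continuous_on UNIV g" for g :: "real \<Rightarrow> real"
    using continuous_on_subset[OF that] by (intro integrable_continuous_real) auto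
  have "(v' has_integral v (2 * pi) - v 0) {0..2*pi}"
    using v(1) by (intro fundamental_theorem_of_calculus)
      (auto intro: has_field_derivative_at_within simp: has_real_derivative_iff_has_vector_derivative[symmetric])
  then have v0: "integral {0..2*pi} (\<lambda>x. 2 * m * v' x) = 0" using per(3) by (simp add: integral_unique)
  \<comment> \<open>Replacing \<open>u\<close> by \<open>u - m\<close> costs
    \<open>2 * m * v'\<close>, which integrates to zero because \<open>v\<close> closes up. What is
    left is Wirtinger's integrand plus a square.\<close>
  have split: "(\<lambda>x. (u' x)\<^sup>2 + (v' x)\<^sup>2 + 2 * (u x * v' x))
    = (\<lambda>x. ((u' x)\<^sup>2 - (u x - m)\<^sup>2) + (((u x - m) + v' x)\<^sup>2 + 2 * m * v' x))"
    by (simp add: fun_eq_iff power2_eq_square algebra_simps)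
  have int_split: "integral {0..2*pi} (\<lambda>x. ((u' x)\<^sup>2 - (u x - m)\<^sup>2) + (((u x - m) + v' x)\<^sup>2 + 2 * m * v' x))
      = integral {0..2*pi} (\<lambda>x. (u' x)\<^sup>2 - (u x - m)\<^sup>2)
      + (integral {0..2*pi} (\<lambda>x. ((u x - m) + v' x)\<^sup>2) + integral {0..2*pi} (\<lambda>x. 2 * m * v' x))"
    by (subst Henstock_Kurzweil_Integration.integral_add;
        (subst Henstock_Kurzweil_Integration.integral_add)?;
        (intro int continuous_intros u(2) v(2) cu)?; simp)
  have "0 \<le> integral {0..2*pi} (\<lambda>x. ((u x - m) + v' x)\<^sup>2)"
    by (intro integral_nonneg int continuous_intros cu v) simp
  then show ?thesis unfolding split int_split v0 using m by linarith
qed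

text \<open>The one-dimensional inequality holds on every coordinate circle, with a constant
  \<open>m\<close> that may change from circle to circle; integrating over the circles gives the
  claim.\<close>

lemma torus_isoperimetric_form_nonneg:
  fixes f a :: "real \<times> real \<Rightarrow> real"
  assumes f: "smooth_map_on f UNIV" "torus_periodic f" and a: "smooth_map_on a UNIV" "torus_periodic a"
  shows "0 \<le> torus_integral (\<lambda>p. (ddir (1, 0) f p)\<^sup>2 + (ddir (1, 0) a p)\<^sup>2 + 2 * (f p * ddir (1, 0) a p))"
      (is "0 \<le> torus_integral ?g1")
    and "0 \<le> torus_integral (\<lambda>p. (ddir (0, 1) f p)\<^sup>2 + (ddir (0, 1) a p)\<^sup>2 + 2 * (f p * ddir (0, 1) a p))"
      (is "0 \<le> torus_integral ?g2")
proof -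
  have c: "continuous_on UNIV f" "continuous_on UNIV (ddir v f)" "continuous_on UNIV (ddir v a)" for v
    by (intro smooth_map_on_continuous smooth_ddir f a open_UNIV)+
  have c1: "continuous_on UNIV (\<lambda>x. g (x, y))" and c2: "continuous_on UNIV (\<lambda>y. g (x, y))"
    if "continuous_on UNIV g" for g :: "real \<times> real \<Rightarrow> real" and x y
    by (auto intro!: continuous_on_compose2[OF that] continuous_intros)
  have g: "continuous_on UNIV ?g1" "continuous_on UNIV ?g2" by (intro continuous_intros c)+
  note p = torus_periodicD[OF f(2)] torus_periodicD[OF torus_periodic_ddir[OF f]]
    torus_periodicD[OF a(2)]
  have "0 \<le> integral {0..2*pi} (\<lambda>y. integral {0..2*pi} (\<lambda>x. ?g1 (x, y)))"
  proof (rule integral_nonneg[OF torus_integral_iterated(4)[OF g(1)]])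
    fix y
    show "0 \<le> integral {0..2*pi} (\<lambda>x. ?g1 (x, y))"
      by (rule isoperimetric_form_nonneg[OF line_derivative(1)[OF f(1)] c1[OF c(2)]
            line_derivative(1)[OF a(1)] c1[OF c(3)]])
        (use p(1) p(3) p(5)[of 0] in auto)
  qed
  then show "0 \<le> torus_integral ?g1" unfolding torus_integral_iterated(2)[OF g(1)] by simp
  have "0 \<le> integral {0..2*pi} (\<lambda>x. integral {0..2*pi} (\<lambda>y. ?g2 (x, y)))"
  proof (rule integral_nonneg[OF torus_integral_iterated(3)[OF g(2)]])
    fix x
    show "0 \<le> integral {0..2*pi} (\<lambda>y. ?g2 (x, y))"
      by (rule isoperimetric_form_nonneg[OF line_derivative(2)[OF f(1)] c2[OF c(2)]
            line_derivative(2)[OF a(1)] c2[OF c(3)]])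
        (use p(2) p(4) p(6)[of _ 0] in auto)
  qed
  then show "0 \<le> torus_integral ?g2" unfolding torus_integral_iterated(1)[OF g(2)] by simp
qed

section \<open>The Laplacian in the frame that rotates along the two circles\<close>

lemma laplacian_eq:
  assumes "smooth_map_on f UNIV"
  shows "laplacian f p = 4 *\<^sub>R (ddir (1, 0) (ddir (1, 0) f) p + ddir (0, 1) (ddir (0, 1) f) p)"
proof -
  have *: "ddir (c *\<^sub>R e) (ddir (c *\<^sub>R e) f) p = (c * c) *\<^sub>R ddir e (ddir e f) p" for c e
  proof -
    have eq: "ddir (c *\<^sub>R e) f = (\<lambda>q. c *\<^sub>R ddir e f q)"
      by (rule ext) (rule linear_cmul[OF linear_ddir[OF smooth_map_on_UNIV_differentiable[OF assms]]])
    have d: "ddir e f differentiable (at p)"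
      by (intro smooth_map_on_UNIV_differentiable smooth_ddir assms open_UNIV)
    show ?thesis
      unfolding eq
      by (subst ddir_linear_compose[OF bounded_linear_scaleR_right d])
        (simp add: linear_cmul[OF linear_ddir[OF d]])
  qed
  show ?thesis
    using *[of 2 "(1, 0)"] *[of 2 "(0, 1)"] by (simp add: laplacian_def torus_frame_def scaleR_add_right)
qed

lemma laplacian_component:
  fixes v :: "real \<times> real \<Rightarrow> real^'n"
  assumes "smooth_map_on v UNIV"
  shows "laplacian v p $ i = laplacian (\<lambda>p. v p $ i) p"
proof -
  have "ddir e (\<lambda>p. w p $ i) = (\<lambda>p. ddir e w p $ i)" if "smooth_map_on w UNIV"
    for e and w :: "real \<times> real \<Rightarrow> real^'n"
    by (rule ext) (rule ddir_linear_compose[OF bounded_linear_vec_nth smooth_map_on_UNIV_differentiable[OF that]])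
  note * = this
  show ?thesis
    unfolding laplacian_def *[OF assms] *[OF smooth_ddir[OF open_UNIV assms]]
    by (simp add: torus_frame_def)
qed

text \<open>The two expressions are the real and imaginary parts of
  \<open>(R + i A) exp (i t)\<close>. The rotation of the frame adds \<open>i T v (R + i A)\<close>
  to the derivative of the coefficient.\<close>

lemma ddir_rotation:
  fixes R A :: "real \<times> real \<Rightarrow> real"
  assumes R: "smooth_map_on R UNIV" and A: "smooth_map_on A UNIV"
    and t: "\<And>p. (t has_derivative T) (at p)"
  shows "ddir v (\<lambda>p. R p * cos (t p) - A p * sin (t p))
      = (\<lambda>p. (ddir v R p - T v * A p) * cos (t p) - (ddir v A p + T v * R p) * sin (t p))"
    and "ddir v (\<lambda>p. R p * sin (t p) + A p * cos (t p))
      = (\<lambda>p. (ddir v R p - T v * A p) * sin (t p) + (ddir v A p + T v * R p) * cos (t p))"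
proof -
  have d: "(R has_derivative (\<lambda>v. ddir v R p)) (at p)" "(A has_derivative (\<lambda>v. ddir v A p)) (at p)" for p
    by (intro ddir_has_derivative smooth_map_on_UNIV_differentiable R A)+
  have "((\<lambda>p. R p * cos (t p) - A p * sin (t p)) has_derivative
      (\<lambda>v. (ddir v R p - T v * A p) * cos (t p) - (ddir v A p + T v * R p) * sin (t p))) (at p)" for p
    by (auto intro!: derivative_eq_intros d t simp: algebra_simps)
  then show "ddir v (\<lambda>p. R p * cos (t p) - A p * sin (t p))
      = (\<lambda>p. (ddir v R p - T v * A p) * cos (t p) - (ddir v A p + T v * R p) * sin (t p))"
    by (intro ext ddirI)
  have "((\<lambda>p. R p * sin (t p) + A p * cos (t p)) has_derivative
      (\<lambda>v. (ddir v R p - T v * A p) * sin (t p) + (ddir v A p + T v * R p) * cos (t p))) (at p)" for p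
    by (auto intro!: derivative_eq_intros d t simp: algebra_simps)
  then show "ddir v (\<lambda>p. R p * sin (t p) + A p * cos (t p))
      = (\<lambda>p. (ddir v R p - T v * A p) * sin (t p) + (ddir v A p + T v * R p) * cos (t p))"
    by (intro ext ddirI)
qed

text \<open>The previous rule applied twice; as the angle \<open>T\<close> is linear,
  \<open>T v\<close> is constant and no second derivative of the angle occurs.\<close>

lemma ddir2_rotation:
  fixes R A :: "real \<times> real \<Rightarrow> real"
  assumes R: "smooth_map_on R UNIV" and A: "smooth_map_on A UNIV" and T: "bounded_linear T"
  shows "ddir v (ddir v (\<lambda>p. R p * cos (T p) - A p * sin (T p))) p
      = (ddir v (ddir v R) p - 2 * T v * ddir v A p - (T v)\<^sup>2 * R p) * cos (T p)
        - (ddir v (ddir v A) p + 2 * T v * ddir v R p - (T v)\<^sup>2 * A p) * sin (T p)"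
    and "ddir v (ddir v (\<lambda>p. R p * sin (T p) + A p * cos (T p))) p
      = (ddir v (ddir v R) p - 2 * T v * ddir v A p - (T v)\<^sup>2 * R p) * sin (T p)
        + (ddir v (ddir v A) p + 2 * T v * ddir v R p - (T v)\<^sup>2 * A p) * cos (T p)"
proof -
  note t = bounded_linear_imp_has_derivative[OF T]
  have R': "smooth_map_on (\<lambda>p. ddir v R p - T v * A p) UNIV"
    and A': "smooth_map_on (\<lambda>p. ddir v A p + T v * R p) UNIV"
    by (intro smooth_intros R A open_UNIV)+
  note d = smooth_map_on_UNIV_differentiable[OF R] smooth_map_on_UNIV_differentiable[OF A]
    smooth_map_on_UNIV_differentiable[OF smooth_ddir[OF open_UNIV R]]
    smooth_map_on_UNIV_differentiable[OF smooth_ddir[OF open_UNIV A]]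
  have c: "ddir v (\<lambda>p. T v * f p) p = T v * ddir v f p" if "f differentiable (at p)"
    for f :: "real \<times> real \<Rightarrow> real"
    by (rule ddir_linear_compose[OF bounded_linear_mult_right that])
  have dR: "ddir v (\<lambda>p. ddir v R p - T v * A p) p = ddir v (ddir v R) p - T v * ddir v A p"
    and dA: "ddir v (\<lambda>p. ddir v A p + T v * R p) p = ddir v (ddir v A) p + T v * ddir v R p"
    using d by (simp_all add: ddir_diff ddir_add c differentiable_mult)
  show "ddir v (ddir v (\<lambda>p. R p * cos (T p) - A p * sin (T p))) p
      = (ddir v (ddir v R) p - 2 * T v * ddir v A p - (T v)\<^sup>2 * R p) * cos (T p)
        - (ddir v (ddir v A) p + 2 * T v * ddir v R p - (T v)\<^sup>2 * A p) * sin (T p)"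
    unfolding ddir_rotation(1)[OF R A t] ddir_rotation(1)[OF R' A' t] dR dA
    by (simp add: algebra_simps power2_eq_square)
  show "ddir v (ddir v (\<lambda>p. R p * sin (T p) + A p * cos (T p))) p
      = (ddir v (ddir v R) p - 2 * T v * ddir v A p - (T v)\<^sup>2 * R p) * sin (T p)
        + (ddir v (ddir v A) p + 2 * T v * ddir v R p - (T v)\<^sup>2 * A p) * cos (T p)"
    unfolding ddir_rotation(2)[OF R A t] ddir_rotation(2)[OF R' A' t] dR dA
    by (simp add: algebra_simps power2_eq_square)
qed

text \<open>The operator \<open>L\<close> of the overview. \<open>laplacian\<close> is four times
  it, whence the factor 16 in quadratic expressions.\<close>

definition flat_laplacian :: "(real \<times> real \<Rightarrow> real) \<Rightarrow> real \<times> real \<Rightarrow> real" where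
  "flat_laplacian f p = ddir (1, 0) (ddir (1, 0) f) p + ddir (0, 1) (ddir (0, 1) f) p"

text \<open>In each plane \<open>v\<close> is split along the radius and the tangent of the circle.
  Tangency to the sphere forces opposite radial components, so one function \<open>r\<close>
  describes both.\<close>

lemma clifford_frame:
  assumes v: "v \<in> sphere_sections clifford_torus"
  obtains r a b where
    "smooth_map_on r UNIV" "torus_periodic r" "smooth_map_on a UNIV" "torus_periodic a"
    "smooth_map_on b UNIV" "torus_periodic b"
    "\<And>p. v p $ 1 = r p * cos (fst p) - a p * sin (fst p)"
    "\<And>p. v p $ 2 = r p * sin (fst p) + a p * cos (fst p)"
    "\<And>p. v p $ 3 = - r p * cos (snd p) - b p * sin (snd p)"
    "\<And>p. v p $ 4 = - r p * sin (snd p) + b p * cos (snd p)"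
proof -
  note vd = sphere_sectionsD[OF v]
  define r where "r p = v p $ 1 * cos (fst p) + v p $ 2 * sin (fst p)" for p
  define a where "a p = v p $ 2 * cos (fst p) - v p $ 1 * sin (fst p)" for p
  define b where "b p = v p $ 4 * cos (snd p) - v p $ 3 * sin (snd p)" for p
  \<comment> \<open>The product of \<open>v p\<close> with \<open>clifford_torus p\<close> is half
    the sum of the two radial components.\<close>
  have r2: "- r p = v p $ 3 * cos (snd p) + v p $ 4 * sin (snd p)" for p
    using vd(3)[of p]
    by (simp add: inner_real_4 clifford_torus_def case_prod_beta vector_4 r_def)
  have comp: "smooth_map_on (\<lambda>p. v p $ i) UNIV" for i
    by (rule smooth_linear_compose[OF bounded_linear_vec_nth open_UNIV vd(1)])
  have "smooth_map_on r UNIV" "smooth_map_on a UNIV" "smooth_map_on b UNIV"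
    unfolding r_def a_def b_def by (intro smooth_intros comp open_UNIV)+
  moreover have "torus_periodic r" "torus_periodic a" "torus_periodic b"
    using vd(2) unfolding torus_periodic_def r_def a_def b_def by simp_all
  moreover have rot: "x = (x * cos t + y * sin t) * cos t - (y * cos t - x * sin t) * sin t"
    "y = (x * cos t + y * sin t) * sin t + (y * cos t - x * sin t) * cos t" for x y t :: real
    using sin_cos_squared_add[of t] by algebra+
  ultimately show thesis
    by (intro that[of r a b]) (simp_all only: r2, simp_all only: r_def a_def b_def rot[symmetric])
qed

text \<open>The pairs \<open>(x, \<alpha>)\<close> and \<open>(y, \<beta>)\<close> are the radial
  and tangential components of a quarter of \<open>laplacian v\<close> in the two planes. The torus
  has radial components 1/2, so its product with \<open>laplacian v\<close> is
  \<open>2 * (x p + y p)\<close>, which produces the term with the quarter.\<close>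

lemma laplacian_clifford_frame:
  fixes v :: "real \<times> real \<Rightarrow> real^4"
  assumes v: "smooth_map_on v UNIV"
    and r: "smooth_map_on r UNIV" and a: "smooth_map_on a UNIV" and b: "smooth_map_on b UNIV"
    and comps: "\<And>p. v p $ 1 = r p * cos (fst p) - a p * sin (fst p)"
    "\<And>p. v p $ 2 = r p * sin (fst p) + a p * cos (fst p)"
    "\<And>p. v p $ 3 = - r p * cos (snd p) - b p * sin (snd p)"
    "\<And>p. v p $ 4 = - r p * sin (snd p) + b p * cos (snd p)"
  defines "x \<equiv> \<lambda>p. flat_laplacian r p - 2 * ddir (1, 0) a p - r p"
    and "y \<equiv> \<lambda>p. - flat_laplacian r p - 2 * ddir (0, 1) b p + r p"
    and "\<alpha> \<equiv> \<lambda>p. flat_laplacian a p + 2 * ddir (1, 0) r p - a p"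
    and "\<beta> \<equiv> \<lambda>p. flat_laplacian b p - 2 * ddir (0, 1) r p - b p"
  shows "laplacian v p \<bullet> laplacian v p - (laplacian v p \<bullet> clifford_torus p)\<^sup>2 + 4 * (laplacian v p \<bullet> v p)
    = 16 * ((x p)\<^sup>2 + (y p)\<^sup>2 + (\<alpha> p)\<^sup>2 + (\<beta> p)\<^sup>2 - (x p + y p)\<^sup>2 / 4
        + (x p * r p - y p * r p + \<alpha> p * a p + \<beta> p * b p))"
proof -
  have mr: "smooth_map_on (\<lambda>p. - r p) UNIV" by (intro smooth_intros r open_UNIV)
  have dmr: "ddir e (\<lambda>p. - g p) = (\<lambda>p. - ddir e g p)" if "smooth_map_on g UNIV"
    for e and g :: "real \<times> real \<Rightarrow> real"
    by (rule ext) (rule ddir_linear_compose[OF bounded_linear_minus[OF bounded_linear_ident]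
          smooth_map_on_UNIV_differentiable[OF that]])
  have sm: "smooth_map_on (\<lambda>p. v p $ i) UNIV" for i
    by (rule smooth_linear_compose[OF bounded_linear_vec_nth open_UNIV v])
  note L = laplacian_component[OF v] laplacian_eq[OF sm]
  note ddmr = dmr[OF r] dmr[OF smooth_ddir[OF open_UNIV r]]
  have L1: "laplacian v p $ 1 = 4 * (x p * cos (fst p) - \<alpha> p * sin (fst p))"
    unfolding L unfolding comps(1) unfolding ddir2_rotation(1)[OF r a bounded_linear_fst] x_def \<alpha>_def flat_laplacian_def
    by (simp add: algebra_simps)
  have L2: "laplacian v p $ 2 = 4 * (x p * sin (fst p) + \<alpha> p * cos (fst p))"
    unfolding L unfolding comps(2) unfolding ddir2_rotation(2)[OF r a bounded_linear_fst] x_def \<alpha>_def flat_laplacian_def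
    by (simp add: algebra_simps)
  have L3: "laplacian v p $ 3 = 4 * (y p * cos (snd p) - \<beta> p * sin (snd p))"
    unfolding L unfolding comps(3) unfolding ddir2_rotation(1)[OF mr b bounded_linear_snd] y_def \<beta>_def flat_laplacian_def ddmr
    by (simp add: algebra_simps)
  have L4: "laplacian v p $ 4 = 4 * (y p * sin (snd p) + \<beta> p * cos (snd p))"
    unfolding L unfolding comps(4) unfolding ddir2_rotation(2)[OF mr b bounded_linear_snd] y_def \<beta>_def flat_laplacian_def ddmr
    by (simp add: algebra_simps)
  have rot: "(X * cos t - A * sin t) * (X' * cos t - A' * sin t)
      + (X * sin t + A * cos t) * (X' * sin t + A' * cos t) = X * X' + A * A'" for X A X' A' t :: real
    using sin_cos_squared_add[of t] by algebra
  have i1: "laplacian v p \<bullet> laplacian v p = 16 * ((x p)\<^sup>2 + (y p)\<^sup>2 + (\<alpha> p)\<^sup>2 + (\<beta> p)\<^sup>2)"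
    using rot[of "x p" "fst p" "\<alpha> p" "x p" "\<alpha> p"] rot[of "y p" "snd p" "\<beta> p" "y p" "\<beta> p"]
    unfolding inner_real_4 L1 L2 L3 L4 by algebra
  have i2: "laplacian v p \<bullet> v p = 4 * (x p * r p - y p * r p + \<alpha> p * a p + \<beta> p * b p)"
    using rot[of "x p" "fst p" "\<alpha> p" "r p" "a p"] rot[of "y p" "snd p" "\<beta> p" "- r p" "b p"]
    unfolding inner_real_4 L1 L2 L3 L4 comps by algebra
  have i3: "laplacian v p \<bullet> clifford_torus p = 2 * (x p + y p)"
    using rot[of "x p" "fst p" "\<alpha> p" 1 0] rot[of "y p" "snd p" "\<beta> p" 1 0]
    unfolding inner_real_4 L1 L2 L3 L4 clifford_torus_def case_prod_beta vector_4 by algebra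
  show ?thesis unfolding i1 i2 i3 by (simp add: power2_eq_square algebra_simps)
qed

lemma clifford_form_nonneg:
  fixes r a b :: "real \<times> real \<Rightarrow> real"
  assumes r: "smooth_map_on r UNIV" "torus_periodic r" and a: "smooth_map_on a UNIV" "torus_periodic a"
    and b: "smooth_map_on b UNIV" "torus_periodic b"
  defines "x \<equiv> \<lambda>p. flat_laplacian r p - 2 * ddir (1, 0) a p - r p"
    and "y \<equiv> \<lambda>p. - flat_laplacian r p - 2 * ddir (0, 1) b p + r p"
    and "\<alpha> \<equiv> \<lambda>p. flat_laplacian a p + 2 * ddir (1, 0) r p - a p"
    and "\<beta> \<equiv> \<lambda>p. flat_laplacian b p - 2 * ddir (0, 1) r p - b p"
  shows "0 \<le> torus_integral (\<lambda>p. (x p)\<^sup>2 + (y p)\<^sup>2 + (\<alpha> p)\<^sup>2 + (\<beta> p)\<^sup>2 - (x p + y p)\<^sup>2 / 4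
        + (x p * r p - y p * r p + \<alpha> p * a p + \<beta> p * b p))"
proof -
  let ?X = "ddir (1, 0)" and ?Y = "ddir (0, 1)"
  note sm = smooth_intros r(1) a(1) b(1) open_UNIV
  note per = periodic_intros r(2) a(2) b(2)
  \<comment> \<open>\<open>w + i s\<close> is the Cauchy-Riemann operator \<open>?X + i ?Y\<close>
    applied to \<open>a + i b\<close>, so the gradients of \<open>w\<close> and \<open>s\<close>
    have the same integrated square as the flat Laplacians of \<open>a\<close> and \<open>b\<close>.
    The first variation of the induced metric has diagonal entries \<open>?X a + r\<close> and
    \<open>?Y b - r\<close> and off-diagonal entry \<open>s / 2\<close>, so \<open>u\<close> and
    \<open>s\<close> describe its trace-free part.\<close>
  define w where "w = (\<lambda>p. ?X a p - ?Y b p)"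
  define s where "s = (\<lambda>p. ?Y a p + ?X b p)"
  define u where "u = (\<lambda>p. w p + 2 * r p)"
  have w: "smooth_map_on w UNIV" "torus_periodic w" unfolding w_def by (intro sm, intro per sm)
  have s: "smooth_map_on s UNIV" "torus_periodic s" unfolding s_def by (intro sm, intro per sm)
  have u: "smooth_map_on u UNIV" "torus_periodic u"
    unfolding u_def by (intro sm w, intro per w)
  \<comment> \<open>\<open>h1\<close>, \<open>h2\<close> collect the integrations by parts \<open>f Lf \<rightarrow> - |\<nabla>f|\<^sup>2\<close> and the two Jacobian determinants
    \<open>u\<^sub>\<gamma> s\<^sub>\<theta> - u\<^sub>\<theta> s\<^sub>\<gamma>\<close> and \<open>a\<^sub>\<gamma> b\<^sub>\<theta> - a\<^sub>\<theta> b\<^sub>\<gamma>\<close>\<close>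
  define h1 where "h1 = (\<lambda>p. 2 * (u p * ?Y s p) - a p * ?X a p - b p * ?X b p - 2 * (r p * ?X r p)
      - 2 * (a p * r p) + 2 * (a p * ?Y b p))"
  define h2 where "h2 = (\<lambda>p. 2 * (r p * b p) - 2 * (u p * ?X s p) - a p * ?Y a p - b p * ?Y b p
      - 2 * (r p * ?Y r p) - 2 * (a p * ?X b p))"
  have h1: "smooth_map_on h1 UNIV" "torus_periodic h1" and h2: "smooth_map_on h2 UNIV" "torus_periodic h2"
    unfolding h1_def h2_def by (intro sm u s | intro per u s sm)+
  \<comment> \<open>The radial component in the second plane is \<open>- r\<close>; changing the
    sign of \<open>b\<close> instead gives the second circle the same isoperimetric form as the
    first.\<close>
  define mb where "mb = (\<lambda>p. - b p)"
  have mb: "smooth_map_on mb UNIV" "torus_periodic mb"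
    unfolding mb_def using b(2) by (intro sm, simp add: torus_periodic_def)
  define P1 where "P1 = (\<lambda>p. (?X r p)\<^sup>2 + (?X a p)\<^sup>2 + 2 * (r p * ?X a p))"
  define P2 where "P2 = (\<lambda>p. (?Y r p)\<^sup>2 + (?Y mb p)\<^sup>2 + 2 * (r p * ?Y mb p))"
  define N where "N = (\<lambda>p. 2 * (flat_laplacian r p - w p)\<^sup>2 + (?X u p)\<^sup>2 + (?Y u p)\<^sup>2 + (?X s p)\<^sup>2 + (?Y s p)\<^sup>2 + (s p)\<^sup>2)"
  have fl: "smooth_map_on (flat_laplacian r) UNIV"
  proof -
    have "flat_laplacian r = (\<lambda>p. ?X (?X r) p + ?Y (?Y r) p)" by (rule ext) (rule flat_laplacian_def)
    then show ?thesis by (simp add: smooth_add smooth_ddir r)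
  qed
  have N: "smooth_map_on N UNIV"
    unfolding N_def power2_eq_square by (intro sm fl w u s)
  have P1: "smooth_map_on P1 UNIV" and P2: "smooth_map_on P2 UNIV"
    unfolding P1_def P2_def power2_eq_square by (intro sm mb)+
  have "(x p)\<^sup>2 + (y p)\<^sup>2 + (\<alpha> p)\<^sup>2 + (\<beta> p)\<^sup>2 - (x p + y p)\<^sup>2 / 4
        + (x p * r p - y p * r p + \<alpha> p * a p + \<beta> p * b p)
      = N p + (2 * P1 p + (2 * P2 p + (?X h1 p + ?Y h2 p)))" for p
  proof -
    have D: "(f has_derivative (\<lambda>v. ddir v f p)) (at p)" if "smooth_map_on f UNIV"
      for f :: "real \<times> real \<Rightarrow> real"
      by (rule ddir_has_derivative[OF smooth_map_on_UNIV_differentiable[OF that]])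
    note Ds = D[OF r(1)] D[OF a(1)] D[OF b(1)] D[OF u(1)] D[OF smooth_ddir[OF open_UNIV r(1)]]
      D[OF smooth_ddir[OF open_UNIV a(1)]] D[OF smooth_ddir[OF open_UNIV b(1)]]
      D[OF smooth_ddir[OF open_UNIV s(1)]]
    have "(h1 has_derivative (\<lambda>v. 2 * (u p * ddir v (?Y s) p + ddir v u p * ?Y s p)
        - (a p * ddir v (?X a) p + ddir v a p * ?X a p) - (b p * ddir v (?X b) p + ddir v b p * ?X b p)
        - 2 * (r p * ddir v (?X r) p + ddir v r p * ?X r p) - 2 * (a p * ddir v r p + ddir v a p * r p)
        + 2 * (a p * ddir v (?Y b) p + ddir v a p * ?Y b p))) (at p)"
      unfolding h1_def
      by (intro has_derivative_add has_derivative_diff has_derivative_mult_right has_derivative_mult Ds)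
    note dh1 = ddirI[OF this, of "(1, 0)"]
    have "(h2 has_derivative (\<lambda>v. 2 * (r p * ddir v b p + ddir v r p * b p)
        - 2 * (u p * ddir v (?X s) p + ddir v u p * ?X s p)
        - (a p * ddir v (?Y a) p + ddir v a p * ?Y a p) - (b p * ddir v (?Y b) p + ddir v b p * ?Y b p)
        - 2 * (r p * ddir v (?Y r) p + ddir v r p * ?Y r p)
        - 2 * (a p * ddir v (?X b) p + ddir v a p * ?X b p))) (at p)"
      unfolding h2_def
      by (intro has_derivative_add has_derivative_diff has_derivative_mult_right has_derivative_mult Ds)
    note dh2 = ddirI[OF this, of "(0, 1)"]
    have dd: "ddir v w p = ddir v (?X a) p - ddir v (?Y b) p"
      "ddir v s p = ddir v (?Y a) p + ddir v (?X b) p" for v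
      unfolding w_def s_def
      by (intro ddir_diff ddir_add smooth_map_on_UNIV_differentiable sm)+
    have du: "ddir v u p = ddir v w p + 2 * ddir v r p" for v
      unfolding u_def
      by (rule ddirI[OF has_derivative_add[OF D[OF w(1)] has_derivative_mult_right[OF D[OF r(1)]]]])
    have dmb: "?Y mb p = - ?Y b p"
      unfolding mb_def by (rule ddirI[OF has_derivative_minus[OF D[OF b(1)]]])
    have com: "?Y (?X f) p = ?X (?Y f) p" if "smooth_map_on f UNIV" for f :: "real \<times> real \<Rightarrow> real"
      by (rule ddir_commute[OF open_UNIV that UNIV_I])
    \<comment> \<open>The only third-order terms in \<open>a\<close> and \<open>b\<close> are the
      mixed second derivatives of \<open>s\<close> from \<open>h1\<close> and \<open>h2\<close>;
      they cancel once \<open>com\<close> fixes the order of differentiation, and the rest is a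
      polynomial identity in derivatives at \<open>p\<close>.\<close>
    show ?thesis
      unfolding dh1 dh2 N_def P1_def P2_def dmb du dd com[OF s(1)] com[OF a(1)] com[OF b(1)]
        x_def y_def \<alpha>_def \<beta>_def flat_laplacian_def
      by (simp add: w_def s_def u_def power2_eq_square field_simps)
  qed
  then have "torus_integral (\<lambda>p. (x p)\<^sup>2 + (y p)\<^sup>2 + (\<alpha> p)\<^sup>2 + (\<beta> p)\<^sup>2 - (x p + y p)\<^sup>2 / 4
        + (x p * r p - y p * r p + \<alpha> p * a p + \<beta> p * b p))
    = torus_integral (\<lambda>p. N p + (2 * P1 p + (2 * P2 p + (?X h1 p + ?Y h2 p))))" by presburger
  also have "\<dots> = torus_integral N + (2 * torus_integral P1 + (2 * torus_integral P2
      + (torus_integral (?X h1) + torus_integral (?Y h2))))"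
    by (simp add: torus_integral_add torus_integral_cmult smooth_add smooth_mult smooth_const
        smooth_ddir N P1 P2 h1 h2)
  also have "\<dots> = torus_integral N + 2 * torus_integral P1 + 2 * torus_integral P2"
    using torus_integral_ddir[OF h1] torus_integral_ddir[OF h2] by simp
  also have "\<dots> \<ge> 0"
  proof -
    have "0 \<le> torus_integral N" by (rule torus_integral_nonneg[OF N]) (simp add: N_def)
    moreover have "0 \<le> torus_integral P1" unfolding P1_def by (rule torus_isoperimetric_form_nonneg(1)[OF r a])
    moreover have "0 \<le> torus_integral P2" unfolding P2_def by (rule torus_isoperimetric_form_nonneg(2)[OF r mb])
    ultimately show ?thesis by simp
  qed
  finally show ?thesis .
qed

theorem proposition4p6:
  fixes V :: "real \<times> real \<Rightarrow> (real^4) \<times> real"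
  assumes "V \<in> W_phi"
  shows "hessian_E2_Phi V V \<ge> 0"
proof -
  from assms obtain v where v: "v \<in> sphere_sections clifford_torus" and V: "V = (\<lambda>p. (v p, 0))"
    unfolding W_phi_eq by blast
  from clifford_frame[OF v] obtain r a b where
    rab: "smooth_map_on r UNIV" "torus_periodic r" "smooth_map_on a UNIV" "torus_periodic a"
      "smooth_map_on b UNIV" "torus_periodic b"
    and comps: "\<And>p. v p $ 1 = r p * cos (fst p) - a p * sin (fst p)"
    "\<And>p. v p $ 2 = r p * sin (fst p) + a p * cos (fst p)"
    "\<And>p. v p $ 3 = - r p * cos (snd p) - b p * sin (snd p)"
    "\<And>p. v p $ 4 = - r p * sin (snd p) + b p * cos (snd p)" by metis
  show ?thesis
    unfolding V hessian_E2_Phi_eq[OF v] laplacian_clifford_frame[OF sphere_sectionsD(1)[OF v] rab(1,3,5) comps]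
      torus_integral_cmult
    using clifford_form_nonneg[OF rab] by simp
qed

end
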